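(* Let $\alpha\in\mathbb{R}$, $1<p,q<\infty$ and $0<\lambda<\infty$. Then $$\left(B\vec{\dot K}_{p,q}^{\alpha,\lambda}(\mathbb{R}^n\times\mathbb{R}^m)\right)^*=M\vec{\dot K}_{p',q'}^{-\alpha,\lambda}(\mathbb{R}^n\times\mathbb{R}^m),$$ in the sense that every $f\in M\vec{\dot K}_{p',q'}^{-\alpha,\lambda}(\mathbb{R}^n\times\mathbb{R}^m)$ induces a bounded linear functional $L_f(g)=\int_{\mathbb{R}^n\times\mathbb{R}^m} f(z)g(z)\,dz$ on $B\vec{\dot K}_{p,q}^{\alpha,\lambda}(\mathbb{R}^n\times\mathbb{R}^m)$, and every bounded linear functional on $B\vec{\dot K}_{p,q}^{\alpha,\lambda}(\mathbb{R}^n\times\mathbb{R}^m)$ is of the form $L_f$ for some $f\in M\vec{\dot K}_{p',q'}^{-\alpha,\lambda}(\mathbb{R}^n\times\mathbb{R}^m)$. Furthermore, $$\|f\|_{M\vec{\dot K}_{p',q'}^{-\alpha,\lambda}(\mathbb{R}^n\times\mathbb{R}^m)}\approx\|L_f\|_{\left(B\vec{\dot K}_{p,q}^{\alpha,\lambda}(\mathbb{R}^n\times\mathbb{R}^m)\right)^*}:=\sup_{\|g\|_{B\vec{\dot K}_{p,q}^{\alpha,\lambda}(\mathbb{R}^n\times\mathbb{R}^m)}\le 1}\|fg\|_{L^1(\mathbb{R}^n\times\mathbb{R}^m)},$$ where $A\approx B$ means $C^{-1}A\le B\le CA$ with a constant $C\geq 1$ independent of $f$.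
   Context: $n,m$ are positive integers; $r'$ denotes the conjugate exponent of $r$ ($1/r+1/r'=1$). For $k\in\mathbb{Z}$, $Q_k$ is the cube (in $\mathbb{R}^n$ or $\mathbb{R}^m$) centered at the origin with side length $2^k$; $R_{i,j}=Q_i\times Q_j\subset\mathbb{R}^n\times\mathbb{R}^m$; $I_i=Q_i\setminus Q_{i-1}\subset\mathbb{R}^n$, $J_j=Q_j\setminus Q_{j-1}\subset\mathbb{R}^m$; $\chi_{i,j}$ is the characteristic function of $I_i\times J_j$, and $\chi_E$ that of a set $E$. Product Herz norm: for $a\in\mathbb{R}$, $0<r,s<\infty$ and measurable $f$, $$\|f\|_{\vec{\dot K}_{r,s}^{a}(\mathbb{R}^n\times\mathbb{R}^m)}=\Big(\sum_{i,j\in\mathbb{Z}}2^{(i+j)sa}\|f\chi_{i,j}\|_{L^r(\mathbb{R}^n\times\mathbb{R}^m)}^s\Big)^{1/s}.$$ Product Morrey-Herz space $M\vec{\dot K}_{r,s}^{a,\lambda}(\mathbb{R}^n\times\mathbb{R}^m)$: all $f\in L^r_{\mathrm{loc}}(\mathbb{R}^n\times\mathbb{R}^m\setminus\{(0,0)\})$ with $$\|f\|_{M\vec{\dot K}_{r,s}^{a,\lambda}(\mathbb{R}^n\times\mathbb{R}^m)}=\sup_{L_1,L_2\in\mathbb{Z}}2^{-(L_1+L_2)\lambda}\|f\chi_{R_{L_1,L_2}}\|_{\vec{\dot K}_{r,s}^{a}(\mathbb{R}^n\times\mathbb{R}^m)}<\infty.$$ Product block-Herz space: a measurable function $b$ on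 $\mathbb{R}^n\times\mathbb{R}^m$ is a product Herz-block, written $b\in b\vec{\dot K}_{r,s}^{a,\lambda}(\mathbb{R}^n\times\mathbb{R}^m)$, if it is supported in some $R_{l_1,l_2}$ with $l_1,l_2\in\mathbb{Z}$ and $\|b\|_{\vec{\dot K}_{r,s}^{a}(\mathbb{R}^n\times\mathbb{R}^m)}\le 2^{-\lambda(l_1+l_2)}$. Then $B\vec{\dot K}_{r,s}^{a,\lambda}(\mathbb{R}^n\times\mathbb{R}^m)$ is the set of all $\sum_{k=1}^\infty\lambda_kb_k$ with $\sum_{k=1}^\infty|\lambda_k|<\infty$ and $b_k\in b\vec{\dot K}_{r,s}^{a,\lambda}(\mathbb{R}^n\times\mathbb{R}^m)$, with norm $\|f\|_{B\vec{\dot K}_{r,s}^{a,\lambda}(\mathbb{R}^n\times\mathbb{R}^m)}=\inf\sum_{k=1}^\infty|\lambda_k|$, the infimum being over all such representations $f=\sum_{k=1}^\infty\lambda_kb_k$.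
   Formalization: The Morrey-Herz space is taken with local integrability on (R^n\{0})×(R^m\{0}) instead of R^n×R^m\{(0,0)}: with the latter, surjectivity fails if α+λ≤0. The two spaces are proved equal if α+λ>0, and the latter is always contained in the former. *)

theory Defs
  imports "HOL-Analysis.Analysis"
begin

text \<open>
  Functions live on \<open>(real^'n) \<times> (real^'m)\<close> with Lebesgue measure and are identified only
  through almost-everywhere statements.  Scalars range over a type \<open>'k\<close> of class
  \<open>{real_normed_field, euclidean_space}\<close>; up to isomorphism its only instances are the real
  and the complex numbers, so both scalar fields are covered.  All norms take values in
  \<^typ>\<open>ennreal\<close>, so that they are meaningful for every measurable function.
\<close>

text \<open>Power with exponent \<open>r > 0\<close> on \<open>[0,\<infinity>]\<close>.\<close>

definition epowr :: "ennreal \<Rightarrow> real \<Rightarrow> ennreal" where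
  "epowr x r = (if x = \<infinity> then \<infinity> else ennreal (enn2real x powr r))"

definition Lnorm :: "real \<Rightarrow> ('a::euclidean_space \<Rightarrow> 'k::real_normed_vector) \<Rightarrow> ennreal" where
  "Lnorm r f = epowr (\<integral>\<^sup>+ z. ennreal (norm (f z) powr r) \<partial>lebesgue) (1 / r)"

definition Lloc :: "real \<Rightarrow> 'a::euclidean_space set \<Rightarrow> ('a \<Rightarrow> 'k::real_normed_vector) set" where
  "Lloc r \<Omega> = {f. f \<in> borel_measurable lebesgue \<and>
     (\<forall>K. compact K \<and> K \<subseteq> \<Omega> \<longrightarrow> Lnorm r (\<lambda>z. indicator K z *\<^sub>R f z) < \<infinity>)}"

text \<open>Closed cubes, so that ``supported in a cube'' means the same for the set where a function
  is nonzero and for its closure.\<close>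

definition cube :: "int \<Rightarrow> (real^'n) set" where
  "cube k = {x. \<forall>i. \<bar>x $ i\<bar> \<le> 2 powr real_of_int k / 2}"

definition cube_shell :: "int \<Rightarrow> (real^'n) set" where
  "cube_shell k = cube k - cube (k - 1)"

definition herz_norm ::
  "real \<Rightarrow> real \<Rightarrow> real \<Rightarrow> ((real^'n) \<times> (real^'m) \<Rightarrow> 'k::real_normed_vector) \<Rightarrow> ennreal" where
  "herz_norm a r s f = epowr
     (\<Sum>\<^sub>\<infinity>(i, j)\<in>UNIV. ennreal (2 powr (real_of_int (i + j) * s * a)) *
        epowr (Lnorm r (\<lambda>z. indicator (cube_shell i \<times> cube_shell j) z *\<^sub>R f z)) s)
     (1 / s)"

definition morrey_herz_norm ::
  "real \<Rightarrow> real \<Rightarrow> real \<Rightarrow> real \<Rightarrow> ((real^'n) \<times> (real^'m) \<Rightarrow> 'k::real_normed_vector) \<Rightarrow> ennreal" where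
  "morrey_herz_norm a l r s f =
     (SUP L1::int. SUP L2::int. ennreal (2 powr (- (real_of_int (L1 + L2) * l))) *
        herz_norm a r s (\<lambda>z. indicator (cube L1 \<times> cube L2) z *\<^sub>R f z))"

text \<open>
  The Morrey-Herz space, with the domain \<open>\<Omega>\<close> of local integrability as a parameter.  The shells
  exhaust the product of the two punctured spaces, and for \<open>\<Omega> = (- {0}) \<times> (- {0})\<close> local
  integrability is a consequence of finiteness of the norm.  For the larger set
  \<open>\<Omega> = - {(0, 0)}\<close> this is so only if \<open>a < l\<close>: otherwise functions of finite norm may fail to be
  locally integrable at points \<open>(x, 0)\<close> and \<open>(0, y)\<close>.
\<close>

definition morrey_herz_on ::
  "((real^'n) \<times> (real^'m)) set \<Rightarrow> real \<Rightarrow> real \<Rightarrow> real \<Rightarrow> real \<Rightarrow>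
     ((real^'n) \<times> (real^'m) \<Rightarrow> 'k::real_normed_vector) set" where
  "morrey_herz_on \<Omega> a l r s = {f \<in> Lloc r \<Omega>. morrey_herz_norm a l r s f < \<infinity>}"

abbreviation morrey_herz ::
  "real \<Rightarrow> real \<Rightarrow> real \<Rightarrow> real \<Rightarrow>
     ((real^'n) \<times> (real^'m) \<Rightarrow> 'k::real_normed_vector) set" where
  "morrey_herz \<equiv> morrey_herz_on ((- {0}) \<times> (- {0}))"

definition herz_block ::
  "real \<Rightarrow> real \<Rightarrow> real \<Rightarrow> real \<Rightarrow>
     ((real^'n) \<times> (real^'m) \<Rightarrow> 'k::real_normed_vector) set" where
  "herz_block a l r s = {b \<in> borel_measurable lebesgue. \<exists>l1 l2 :: int.
     (AE z in lebesgue. z \<notin> cube l1 \<times> cube l2 \<longrightarrow> b z = 0) \<and>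
     herz_norm a r s b \<le> ennreal (2 powr (- (l * real_of_int (l1 + l2))))}"

text \<open>
  Representation of \<open>f\<close> as \<open>\<Sum>k. c k * b k\<close>.  If \<open>l > 0\<close> and \<open>r \<ge> 1\<close>, the \<open>L\<^sup>r\<close> norms of blocks on
  any fixed product of shells are uniformly bounded, so such a series always converges absolutely
  almost everywhere.
\<close>

definition block_rep ::
  "real \<Rightarrow> real \<Rightarrow> real \<Rightarrow> real \<Rightarrow> ((real^'n) \<times> (real^'m) \<Rightarrow> 'k) \<Rightarrow>
     (nat \<Rightarrow> 'k::real_normed_field) \<Rightarrow> (nat \<Rightarrow> (real^'n) \<times> (real^'m) \<Rightarrow> 'k) \<Rightarrow> bool" where
  "block_rep a l r s f c b \<longleftrightarrow>
     summable (\<lambda>k. norm (c k)) \<and> (\<forall>k. b k \<in> herz_block a l r s) \<and>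
     (AE z in lebesgue. (\<lambda>k. c k * b k z) sums f z)"

definition block_herz ::
  "real \<Rightarrow> real \<Rightarrow> real \<Rightarrow> real \<Rightarrow>
     ((real^'n) \<times> (real^'m) \<Rightarrow> 'k::real_normed_field) set" where
  "block_herz a l r s = {f \<in> borel_measurable lebesgue. \<exists>c b. block_rep a l r s f c b}"

definition block_herz_norm ::
  "real \<Rightarrow> real \<Rightarrow> real \<Rightarrow> real \<Rightarrow>
     ((real^'n) \<times> (real^'m) \<Rightarrow> 'k::real_normed_field) \<Rightarrow> ennreal" where
  "block_herz_norm a l r s f =
     Inf {ennreal (\<Sum>k. norm (c k)) | c b. block_rep a l r s f c b}"

text \<open>
  Bounded \<open>'k\<close>-linear functionals on the block space.  Functions that agree almost everywhere have
  a difference of norm zero, so boundedness makes \<open>\<Lambda>\<close> well defined on classes.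
\<close>

definition block_herz_dual ::
  "real \<Rightarrow> real \<Rightarrow> real \<Rightarrow> real \<Rightarrow>
     (((real^'n) \<times> (real^'m) \<Rightarrow> 'k::real_normed_field) \<Rightarrow> 'k) set" where
  "block_herz_dual a l r s = {\<Lambda>.
     (\<forall>g\<in>block_herz a l r s. \<forall>h\<in>block_herz a l r s. \<Lambda> (\<lambda>z. g z + h z) = \<Lambda> g + \<Lambda> h) \<and>
     (\<forall>c. \<forall>g\<in>block_herz a l r s. \<Lambda> (\<lambda>z. c * g z) = c * \<Lambda> g) \<and>
     (\<exists>C\<ge>0. \<forall>g\<in>block_herz a l r s.
        ennreal (norm (\<Lambda> g)) \<le> ennreal C * block_herz_norm a l r s g)}"

definition pairing_norm ::
  "real \<Rightarrow> real \<Rightarrow> real \<Rightarrow> real \<Rightarrow>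
     ((real^'n) \<times> (real^'m) \<Rightarrow> 'k::real_normed_field) \<Rightarrow> ennreal" where
  "pairing_norm a l r s f =
     (SUP g\<in>{g \<in> block_herz a l r s. block_herz_norm a l r s g \<le> 1}. Lnorm 1 (\<lambda>z. f z * g z))"

end

theory Submission
  imports Defs
begin

text \<open>
  On the products of shells, the Herz norm is a weighted sequence norm of \<open>L\<^sup>r\<close> norms.  Hoelder's
  inequality on every shell and then for the sequence of norms bounds \<open>\<integral> \<bar>f b\<bar>\<close>, for a block \<open>b\<close>
  supported in a rectangle, by the Herz norm of \<open>f\<close> on this rectangle times the Herz norm of \<open>b\<close>;
  the normalisation of blocks turns this into the Morrey-Herz norm of \<open>f\<close>.  Both inequalities are
  attained, so testing against blocks recovers the Morrey-Herz norm exactly.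

  A bounded functional \<open>\<Lambda>\<close> gives an additive set function \<open>A \<mapsto> \<Lambda> (indicator A)\<close> bounded by a
  multiple of \<open>\<mu>(A)\<^sup>1\<^sup>/\<^sup>p\<close> on bounded sets away from the two coordinate subspaces.  Its Radon-Nikodym
  densities glue to a function \<open>f\<close>.  Simple functions are dense in every Herz space of functions
  supported in a fixed rectangle, hence \<open>\<Lambda> b = \<integral> f b\<close> for every block \<open>b\<close> with \<open>f b\<close> integrable.
  Testing against such blocks shows that \<open>f\<close> has finite Morrey-Herz norm, which makes \<open>f b\<close>
  integrable for all blocks, and the series expansion into blocks does the rest.
\<close>

section \<open>Powers and norms with values in \<open>[0,\<infinity>]\<close>\<close>

text \<open>All norms depend on moduli only, so the analysis is done for functions with values in
  [0,infinity], where Hoelder's inequality and its extremals can be written down before anything is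
  known to be integrable. Scalars return at the end through a change of phase. Two obstacles shape
  the proof. For very negative alpha the weights blow up near the coordinate subspaces, so that even
  the indicator of a cube can have infinite Herz norm. Functionals are therefore first tested on
  sets inside \<open>core n\<close>, a product of annuli that meets finitely many shells. Secondly,
  the formula for the functional on a block presupposes that f times the block is integrable, which
  in general follows only from the norm bound still to be proved. The circle is broken by truncating
  f in height and to \<open>core n\<close>: the extremal of the truncated function is a block with
  finite pairing, and the bound obtained does not depend on the truncation. The factor in the
  normalisation of blocks equals the factor in the Morrey-Herz supremum, so the two norms in the
  theorem agree with constant 1.\<close>

lemma epowr_ennreal [simp]: "0 \<le> x \<Longrightarrow> epowr (ennreal x) r = ennreal (x powr r)"
  by (simp add: epowr_def)

lemma epowr_top [simp]: "epowr top r = top"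
  by (simp add: epowr_def)

lemma epowr_0 [simp]: "epowr 0 r = 0"
  by (simp add: epowr_def)

lemma epowr_1 [simp]: "epowr x 1 = x"
  by (cases x) simp_all

lemma epowr_one [simp]: "epowr 1 r = 1"
  using epowr_ennreal[of 1 r] by simp

lemma epowr_mono: "0 \<le> r \<Longrightarrow> x \<le> y \<Longrightarrow> epowr x r \<le> epowr y r"
  by (cases x; cases y) (auto simp: powr_mono2 top_unique)

text \<open>The values 0 and top are fixed by every power, whatever the sign of the exponent, so
  both sides also agree for the product of 0 and top.\<close>

lemma epowr_mult: "epowr (x * y) r = epowr x r * epowr y r"
  by (cases x; cases y)
    (auto simp: powr_mult ennreal_mult[symmetric] ennreal_top_mult ennreal_mult_top)

lemma epowr_epowr: "epowr (epowr x r) s = epowr x (r * s)"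
  by (cases x) (simp_all add: powr_powr)

lemma epowr_add: "epowr x (r + s) = epowr x r * epowr x s"
  by (cases x) (simp_all add: powr_add ennreal_mult[symmetric])

lemma epowr_eq_0_iff [simp]: "epowr x r = 0 \<longleftrightarrow> x = 0"
  by (cases x) auto

lemma epowr_eq_top_iff [simp]: "epowr x r = top \<longleftrightarrow> x = top"
  by (cases x) auto

lemma epowr_less_top_iff [simp]: "epowr x r < top \<longleftrightarrow> x < top"
  by (simp add: less_top[symmetric])

text \<open>The powers r and 1/r are mutually inverse order isomorphisms of [0,infinity]. This
  adjunction is what makes powers commute with suprema and preserve limits at 0.\<close>

lemma epowr_le_iff: "0 < r \<Longrightarrow> epowr x r \<le> y \<longleftrightarrow> x \<le> epowr y (1 / r)"
  using epowr_mono[of r x "epowr y (1/r)"] epowr_mono[of "1/r" "epowr x r" y]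
  by (auto simp: epowr_epowr)

lemma epowr_SUP:
  assumes "0 < r"
  shows "epowr (SUP i\<in>I. x i) r = (SUP i\<in>I. epowr (x i) r)"
proof (rule antisym)
  show "epowr (SUP i\<in>I. x i) r \<le> (SUP i\<in>I. epowr (x i) r)"
    using assms by (auto simp: epowr_le_iff intro!: SUP_least)
      (auto simp: epowr_le_iff[symmetric] intro: SUP_upper)
  show "(SUP i\<in>I. epowr (x i) r) \<le> epowr (SUP i\<in>I. x i) r"
    using assms by (auto intro!: SUP_least epowr_mono SUP_upper)
qed

lemma borel_measurable_epowr [measurable (raw)]:
  assumes [measurable]: "f \<in> borel_measurable M"
  shows "(\<lambda>x. epowr (f x) r) \<in> borel_measurable M"
  unfolding epowr_def by measurable

lemma epowr_tendsto_0:
  assumes r: "0 < r" and x: "(x \<longlongrightarrow> 0) F"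
  shows "((\<lambda>n. epowr (x n) r) \<longlongrightarrow> 0) F"
proof (rule order_tendstoI)
  fix a :: ennreal assume "0 < a"
  then have "0 < epowr a (1 / r)" by (simp add: zero_less_iff_neq_zero)
  then have "\<forall>\<^sub>F n in F. x n < epowr a (1/r)" using order_tendstoD(2)[OF x] by blast
  then show "\<forall>\<^sub>F n in F. epowr (x n) r < a"
  proof eventually_elim
    case (elim n)
    then show ?case
      using epowr_le_iff[of "1/r" a "x n"] r by (auto simp: not_le[symmetric])
  qed
qed simp

text \<open>The measure is a parameter because the same norm serves twice: with Lebesgue measure on
  a shell, and with counting measure on the pairs of shell indices.\<close>

definition nnorm :: "'a measure \<Rightarrow> real \<Rightarrow> ('a \<Rightarrow> ennreal) \<Rightarrow> ennreal" where
  "nnorm M r u = epowr (\<integral>\<^sup>+ x. epowr (u x) r \<partial>M) (1 / r)"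

lemma epowr_nnorm: "0 < r \<Longrightarrow> epowr (nnorm M r u) r = (\<integral>\<^sup>+ x. epowr (u x) r \<partial>M)"
  by (simp add: nnorm_def epowr_epowr)

lemma nnorm_mono_AE: "0 < r \<Longrightarrow> (AE x in M. u x \<le> v x) \<Longrightarrow> nnorm M r u \<le> nnorm M r v"
  unfolding nnorm_def
  by (intro epowr_mono nn_integral_mono_AE) (auto elim!: eventually_mono intro: epowr_mono)

lemma nnorm_mono: "0 < r \<Longrightarrow> (\<And>x. x \<in> space M \<Longrightarrow> u x \<le> v x) \<Longrightarrow> nnorm M r u \<le> nnorm M r v"
  by (rule nnorm_mono_AE) auto

lemma nnorm_cmult:
  assumes "0 < r" and [measurable]: "u \<in> borel_measurable M"
  shows "nnorm M r (\<lambda>x. c * u x) = c * nnorm M r u"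
  using assms(1)
  by (simp add: nnorm_def epowr_mult nn_integral_cmult epowr_epowr)

lemma nnorm_eq_0_iff:
  assumes "0 < r" and [measurable]: "u \<in> borel_measurable M"
  shows "nnorm M r u = 0 \<longleftrightarrow> (AE x in M. u x = 0)"
  by (simp add: nnorm_def nn_integral_0_iff_AE)

lemma nnorm_SUP:
  assumes r: "0 < r" and mono: "\<And>n x. x \<in> space M \<Longrightarrow> u n x \<le> u (Suc n) x"
    and [measurable]: "\<And>n. u n \<in> borel_measurable M"
  shows "nnorm M r (\<lambda>x. SUP n::nat. u n x) = (SUP n. nnorm M r (u n))"
proof -
  have "(\<integral>\<^sup>+ x. (SUP n. epowr (u n x) r) \<partial>M) = (SUP n. \<integral>\<^sup>+ x. epowr (u n x) r \<partial>M)"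
    using r mono by (intro nn_integral_monotone_convergence_SUP_AE) (auto intro!: epowr_mono)
  then show ?thesis
    using r by (simp add: nnorm_def epowr_SUP)
qed

lemma nnorm_tendsto_0:
  assumes r: "0 < r" and [measurable]: "\<And>n. u n \<in> borel_measurable M" "v \<in> borel_measurable M"
    and "\<And>n. AE x in M. u n x \<le> v x" and "nnorm M r v < top"
    and "AE x in M. (\<lambda>n. u n x) \<longlonglongrightarrow> 0"
  shows "(\<lambda>n. nnorm M r (u n)) \<longlonglongrightarrow> 0"
proof -
  have "(\<lambda>n. \<integral>\<^sup>+ x. epowr (u n x) r \<partial>M) \<longlonglongrightarrow> (\<integral>\<^sup>+ x. 0 \<partial>M)"
  proof (rule nn_integral_dominated_convergence[where w = "\<lambda>x. epowr (v x) r"])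
    show "AE x in M. epowr (u n x) r \<le> epowr (v x) r" for n
      using assms(4)[of n] by (rule eventually_mono) (use r in \<open>simp add: epowr_mono\<close>)
    show "(\<integral>\<^sup>+ x. epowr (v x) r \<partial>M) < \<infinity>"
      using assms(5) r by (simp add: epowr_nnorm[symmetric])
    show "AE x in M. (\<lambda>n. epowr (u n x) r) \<longlonglongrightarrow> 0"
      using assms(6) by (rule eventually_mono) (use r in \<open>simp add: epowr_tendsto_0\<close>)
  qed simp_all
  then show ?thesis
    using r by (simp add: nnorm_def epowr_tendsto_0)
qed

section \<open>Conjugate exponents, Hoelder's inequality and its equality case\<close>

lemma conjugate_exponent:
  assumes "1 < p" "1 / p + 1 / p' = (1::real)"
  shows "1 < p'" "p' = p * (p' - 1)" "p = p' * (p - 1)" "p' = p / (p - 1)"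
proof -
  have "1 / p' = (p - 1) / p" using assms by (simp add: diff_divide_distrib)
  then have *: "p' = p / (p - 1)"
      by (metis inverse_divide inverse_eq_divide inverse_inverse_eq div_by_1)
  show "p' = p / (p - 1)" by (rule *)
  show "1 < p'" "p' = p * (p' - 1)" "p = p' * (p - 1)"
    unfolding * using assms(1) by (simp_all add: field_simps)
qed

lemma epowr_Young:
  assumes "1 < p" "1 / p + 1 / p' = 1"
  shows "x * y \<le> ennreal (1 / p) * epowr x p + ennreal (1 / p') * epowr y p'"
proof -
  have p': "1 < p'" using conjugate_exponent assms by blast
  show ?thesis
  proof (cases x; cases y)
    fix a b assume x: "x = ennreal a" "0 \<le> a" and y: "y = ennreal b" "0 \<le> b"
    have "a * b = (a powr p) powr (1/p) * (b powr p') powr (1/p')"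
      using assms p' x y by (simp add: powr_powr)
    also have "\<dots> \<le> 1/p * a powr p + 1/p' * b powr p'"
      using Youngs_inequality_0[of "1/p" "1/p'" "a powr p" "b powr p'"] assms p' x y
        Youngs_inequality[of p p' a b] by (simp add: powr_powr divide_simps)
    finally show ?thesis
      using x y assms p'
      by (simp add: ennreal_mult[symmetric] ennreal_plus[symmetric] del: ennreal_plus)
  qed (use assms p' in \<open>auto simp: ennreal_mult_top ennreal_top_mult\<close>)
qed

text \<open>Scale both functions to norm 1 and integrate Young's inequality. A vanishing norm is
  treated before an infinite one: since 0 * top = 0, the claim then says that the product vanishes
  almost everywhere.\<close>

lemma nnorm_Holder:
  assumes p: "1 < p" "1 / p + 1 / p' = 1"
    and [measurable]: "u \<in> borel_measurable M" "v \<in> borel_measurable M"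
  shows "(\<integral>\<^sup>+ x. u x * v x \<partial>M) \<le> nnorm M p u * nnorm M p' v"
proof -
  have p': "1 < p'" using conjugate_exponent p by blast
  define a b where "a = nnorm M p u" and "b = nnorm M p' v"
  consider "a = 0 \<or> b = 0" | "a \<noteq> 0" "b \<noteq> 0" "a = top \<or> b = top"
    | "0 < a" "0 < b" "a < top" "b < top"
    by (auto simp: less_top[symmetric] zero_less_iff_neq_zero)
  then have "(\<integral>\<^sup>+ x. u x * v x \<partial>M) \<le> a * b"
  proof cases
    case 1
    then have "AE x in M. u x * v x = 0"
      using p p' by (auto simp: a_def b_def nnorm_eq_0_iff elim!: eventually_mono)
    then have "(\<integral>\<^sup>+ x. u x * v x \<partial>M) = 0"
      by (subst nn_integral_0_iff_AE) auto
    then show ?thesis by simp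
  next
    case 2
    then show ?thesis by (auto simp: ennreal_top_mult ennreal_mult_top)
  next
    case 3
    define a' b' where "a' = enn2real a" and "b' = enn2real b"
    have ab: "a = ennreal a'" "b = ennreal b'" "0 < a'" "0 < b'"
      using 3 by (auto simp: a'_def b'_def enn2real_positive_iff)
    have one: "ennreal (1/a') * a = 1" "ennreal (1/b') * b = 1"
      using ab by (simp_all add: ennreal_mult[symmetric])
    have n: "nnorm M p (\<lambda>x. ennreal (1/a') * u x) = 1" "nnorm M p' (\<lambda>x. ennreal (1/b') * v x) = 1"
      using p p' one by (simp_all add: nnorm_cmult a_def[symmetric] b_def[symmetric])
    have "(\<integral>\<^sup>+ x. u x * v x \<partial>M)
        = (\<integral>\<^sup>+ x. (a * b) * ((ennreal (1/a') * u x) * (ennreal (1/b') * v x)) \<partial>M)"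
      using one by (intro nn_integral_cong) (metis (no_types, opaque_lifting) mult.assoc
          mult.commute mult.left_neutral)
    also have "\<dots> = (a * b) * (\<integral>\<^sup>+ x. (ennreal (1/a') * u x) * (ennreal (1/b') * v x) \<partial>M)"
      by (simp add: nn_integral_cmult)
    also have "(\<integral>\<^sup>+ x. (ennreal (1/a') * u x) * (ennreal (1/b') * v x) \<partial>M) \<le>
       (\<integral>\<^sup>+ x. ennreal (1/p) * epowr (ennreal (1/a') * u x) p + ennreal (1/p') * epowr (ennreal
           (1/b') * v x) p' \<partial>M)"
      using p by (intro nn_integral_mono epowr_Young) auto
    also have "\<dots> = ennreal (1/p) * epowr (nnorm M p (\<lambda>x. ennreal (1/a') * u x)) p +
        ennreal (1/p') * epowr (nnorm M p' (\<lambda>x. ennreal (1/b') * v x)) p'"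
      using p p' by (simp add: epowr_nnorm nn_integral_add nn_integral_cmult)
    also have "\<dots> = 1"
      using p p' by (simp add: n ennreal_plus[symmetric] del: ennreal_plus)
    finally show ?thesis by (simp add: mult_left_mono)
  qed
  then show ?thesis by (simp add: a_def b_def)
qed

text \<open>Exact attainment spares every later argument an epsilon. The norm of the witness is
  bounded by 1 rather than equal to 1, so that 0 can serve when the norm of u vanishes.\<close>

lemma nnorm_attained:
  assumes p: "1 < p" "1 / p + 1 / p' = 1"
    and [measurable]: "u \<in> borel_measurable M" and fin: "nnorm M p' u < top"
  obtains v where "v \<in> borel_measurable M" "nnorm M p v \<le> 1"
    "(\<integral>\<^sup>+ x. u x * v x \<partial>M) = nnorm M p' u"
proof (cases "nnorm M p' u = 0")
  case True
  moreover have "nnorm M p (\<lambda>x. 0) = 0" by (simp add: nnorm_def)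
  ultimately show ?thesis by (intro that[of "\<lambda>x. 0"]) simp_all
next
  case False
  note p' = conjugate_exponent[OF p]
  define A where "A = enn2real (nnorm M p' u)"
  have A: "nnorm M p' u = ennreal A" "0 < A"
    using fin False by (auto simp: A_def enn2real_positive_iff zero_less_iff_neq_zero)
  have int: "(\<integral>\<^sup>+ x. epowr (u x) p' \<partial>M) = ennreal (A powr p')"
    using epowr_nnorm[of p' M u] A p'(1) by simp
  \<comment> \<open>Equality in Hoelder forces v^p to be proportional to u^p', that is v to
    u^(p'-1). The constant normalises v, because p (p'-1) = p'.\<close>
  define v where "v x = ennreal (A powr (1 - p')) * epowr (u x) (p' - 1)" for x
  show ?thesis
  proof (rule that[of v])
    show "v \<in> borel_measurable M" unfolding v_def by measurable
    have "nnorm M p v = ennreal (A powr (1 - p')) * epowr (ennreal (A powr p')) (1/p)"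
      unfolding v_def using p p'(2)
      by (subst nnorm_cmult) (simp_all add: nnorm_def epowr_epowr mult.commute[of "p' - 1"]
          int[symmetric])
    also have "\<dots> = ennreal (A powr (1 - p') * A powr (p' / p))"
      by (simp add: ennreal_mult[symmetric] powr_powr)
    also have "p' / p = p' - 1" using p p'(2)
        by (metis nonzero_mult_div_cancel_left not_one_less_zero)
    finally show "nnorm M p v \<le> 1"
      using A by (simp add: powr_add[symmetric])
    have "u x * v x = ennreal (A powr (1 - p')) * epowr (u x) p'" for x
      using epowr_add[of "u x" 1 "p' - 1"] by (simp add: v_def mult_ac)
    then have "(\<integral>\<^sup>+ x. u x * v x \<partial>M) = ennreal (A powr (1 - p')) * ennreal (A powr p')"
      by (simp add: nn_integral_cmult int)
    also have "\<dots> = nnorm M p' u"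
      using A by (simp add: ennreal_mult[symmetric] powr_add[symmetric])
    finally show "(\<integral>\<^sup>+ x. u x * v x \<partial>M) = nnorm M p' u" .
  qed
qed

text \<open>The Herz norm is defined by an unordered sum over pairs of integers. As an integral for
  counting measure it is open to monotone and dominated convergence, Tonelli and Hoelder.\<close>

lemma infsum_eq_nn_integral_count_space:
  fixes f :: "'a::countable \<Rightarrow> ennreal"
  shows "infsum f UNIV = (\<integral>\<^sup>+ x. f x \<partial>count_space UNIV)"
proof -
  have fin: "(\<Sum>x\<in>F. f x) \<le> (\<integral>\<^sup>+ x. f x \<partial>count_space UNIV)" if "finite F" for F
  proof -
    have "(\<Sum>x\<in>F. f x) = (\<integral>\<^sup>+ x. f x * indicator F x \<partial>count_space UNIV)"
      using that by (subst nn_integral_count_space'[of F]) (auto intro!: sum.cong)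
    also have "\<dots> \<le> (\<integral>\<^sup>+ x. f x \<partial>count_space UNIV)"
      by (intro nn_integral_mono) (auto simp: indicator_def)
    finally show ?thesis .
  qed
  define N where "N = (\<lambda>n. {x::'a. to_nat x < n})"
  have N: "finite (N n)" for n
    unfolding N_def by (rule finite_imageD[of to_nat]) (auto intro: finite_subset[of _ "{..<n}"]
        inj_on_subset[OF inj_to_nat])
  have "(\<integral>\<^sup>+ x. f x \<partial>count_space UNIV)
      = (\<integral>\<^sup>+ x. (SUP n. f x * indicator (N n) x) \<partial>count_space UNIV)"
  proof (intro nn_integral_cong antisym)
    fix x
    show "f x \<le> (SUP n. f x * indicator (N n) x)"
      by (rule SUP_upper2[of "Suc (to_nat x)"]) (auto simp: N_def)
    show "(SUP n. f x * indicator (N n) x) \<le> f x"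
      by (rule SUP_least) (auto simp: indicator_def)
  qed
  also have "\<dots> = (SUP n. \<integral>\<^sup>+ x. f x * indicator (N n) x \<partial>count_space UNIV)"
    by (rule nn_integral_monotone_convergence_SUP) (auto simp: incseq_def le_fun_def N_def
        indicator_def)
  also have "\<dots> = (SUP n. \<Sum>x\<in>N n. f x)"
  proof (intro SUP_cong refl)
    fix n show "(\<integral>\<^sup>+ x. f x * indicator (N n) x \<partial>count_space UNIV) = (\<Sum>x\<in>N n. f x)"
      using N by (subst nn_integral_count_space'[of "N n"]) (auto intro!: sum.cong)
  qed
  finally have *: "(\<integral>\<^sup>+ x. f x \<partial>count_space UNIV) = (SUP n. \<Sum>x\<in>N n. f x)" .
  have "infsum f UNIV = (SUP F\<in>{F. finite F \<and> F \<subseteq> UNIV}. sum f F)"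
    by (rule nonneg_infsum_complete) auto
  then show ?thesis
    using N by (intro antisym) (auto intro!: SUP_least fin simp: *[symmetric], auto intro!:
        SUP_mono simp: *)
qed

section \<open>Cubes and shells\<close>

lemma cube_mono:
  assumes "i \<le> j"
  shows "cube i \<subseteq> cube j"
proof -
  have "2 powr real_of_int i / 2 \<le> 2 powr real_of_int j / 2"
    using assms by (simp add: powr_mono)
  then show ?thesis by (auto simp: cube_def intro: order_trans)
qed

lemma closed_cube [simp]: "closed (cube k)"
proof -
  have "cube k = (\<Inter>i. {x. \<bar>x $ i\<bar> \<le> 2 powr real_of_int k / 2})"
    by (auto simp: cube_def)
  also have "closed \<dots>"
    by (intro closed_INT ballI closed_Collect_le continuous_intros)
  finally show ?thesis .
qed

lemma sets_cube [measurable]: "cube k \<in> sets borel"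
  by (simp add: borel_closed)

lemma sets_cube_shell [measurable]: "cube_shell k \<in> sets borel"
  unfolding cube_shell_def by measurable

lemma cube_shell_disjoint: "x \<in> cube_shell i \<Longrightarrow> x \<in> cube_shell j \<Longrightarrow> i = j"
  using cube_mono[of i "j - 1"] cube_mono[of j "i - 1"]
  by (cases i j rule: linorder_cases) (auto simp: cube_shell_def)

lemma norm_le_of_mem_cube:
  assumes "(x :: real^'n) \<in> cube k"
  shows "norm x \<le> real CARD('n) * 2 powr real_of_int k"
proof -
  have "norm x \<le> (\<Sum>i\<in>UNIV. \<bar>x $ i\<bar>)" by (rule norm_le_l1_cart)
  also have "\<dots> \<le> (\<Sum>i\<in>(UNIV::'n set). 2 powr real_of_int k)"
  proof (rule sum_mono)
    fix i
    have "\<bar>x $ i\<bar> \<le> 2 powr real_of_int k / 2" using assms by (simp add: cube_def)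
    also have "\<dots> \<le> 2 powr real_of_int k" by simp
    finally show "\<bar>x $ i\<bar> \<le> 2 powr real_of_int k" .
  qed
  finally show ?thesis by simp
qed

lemma mem_cube_of_norm_le: "norm (x :: real^'n) \<le> 2 powr real_of_int k / 2 \<Longrightarrow> x \<in> cube k"
  unfolding cube_def using component_le_norm_cart order_trans by blast

lemma cball_subset_cube: "\<exists>n::nat. \<forall>x::real^'n. norm x \<le> B \<longrightarrow> x \<in> cube (int n)"
proof -
  obtain n :: nat where n: "2 * B < 2 ^ n"
    using real_arch_pow[of 2 "2 * B"] by auto
  then show ?thesis
    by (intro exI[of _ n]) (auto intro!: mem_cube_of_norm_le simp: powr_realpow)
qed

text \<open>The index - n - 1 is that of the cube removed in \<open>core n\<close>, whose shells
  then have indices exactly from - n to n.\<close>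

lemma cube_subset_ball:
  assumes "0 < d"
  shows "\<exists>n::nat. \<forall>x::real^'n. x \<in> cube (- int n - 1) \<longrightarrow> norm x < d"
proof -
  obtain n :: nat where n: "real CARD('n) / d < 2 ^ n"
    using real_arch_pow[of 2 "real CARD('n) / d"] by auto
  have "norm x < d" if "x \<in> cube (- int n - 1)" for x :: "real^'n"
  proof -
    have "norm x \<le> real CARD('n) * 2 powr (- real n - 1)"
      using norm_le_of_mem_cube[OF that] by simp
    also have "\<dots> \<le> real CARD('n) * 2 powr (- real n)"
      by (intro mult_left_mono) auto
    also have "\<dots> = real CARD('n) / 2 ^ n"
      by (simp add: powr_minus powr_realpow divide_inverse)
    also have "\<dots> < d" using n assms by (simp add: field_simps)
    finally show ?thesis .
  qed
  then show ?thesis by blast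
qed

lemma bounded_cube: "bounded (cube k)"
  by (rule boundedI) (rule norm_le_of_mem_cube)


lemma mem_cube_shell_ex:
  assumes "x \<noteq> 0"
  shows "\<exists>k. x \<in> cube_shell k"
proof -
  obtain m :: nat where m: "x \<in> cube (int m)" using cball_subset_cube by blast
  obtain n :: nat where n: "x \<notin> cube (- int n - 1)"
    using cube_subset_ball[of "norm x"] assms by auto
  have le: "- int n - 1 \<le> int m" by simp
  \<comment> \<open>Climbing from an index whose cube misses x, the first cube that contains x
    determines the shell.\<close>
  have "\<exists>k. x \<in> cube_shell k" if "x \<in> cube k" "- int n - 1 \<le> k" for k
    using that(2,1)
  proof (induction k rule: int_ge_induct)
    case base
    then show ?case using n by simp
  next
    case (step k)
    show ?case
    proof (cases "x \<in> cube k")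
      case False
      with step show ?thesis by (intro exI[of _ "k + 1"]) (simp add: cube_shell_def)
    qed (use step in auto)
  qed
  from this[OF m le] show ?thesis .
qed

section \<open>Product shells and the exhaustion by products of annuli\<close>

definition shell :: "int \<times> int \<Rightarrow> ((real^'n) \<times> (real^'m)) set" where
  "shell ij = cube_shell (fst ij) \<times> cube_shell (snd ij)"

text \<open>Bounded and bounded away from both coordinate subspaces. Only finitely many shells meet
  it, so bounded functions on it have finite Herz norm for every real weight exponent.\<close>

definition core :: "nat \<Rightarrow> ((real^'n) \<times> (real^'m)) set" where
  "core n = (cube (int n) - cube (- int n - 1)) \<times> (cube (int n) - cube (- int n - 1))"

lemma sets_lebesgue_Times [measurable]:
  fixes A :: "'a::euclidean_space set" and B :: "'b::euclidean_space set"
  assumes "A \<in> sets borel" "B \<in> sets borel"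
  shows "A \<times> B \<in> sets lebesgue"
proof -
  have "A \<times> B \<in> sets (borel \<Otimes>\<^sub>M borel)" using assms by (rule pair_measureI)
  then have "A \<times> B \<in> sets borel" by (simp only: borel_prod)
  then show ?thesis by simp
qed

lemma sets_shell [measurable]: "shell ij \<in> sets lebesgue"
  unfolding shell_def by (intro sets_lebesgue_Times sets_cube_shell)

lemma sets_core [measurable]: "core n \<in> sets lebesgue"
  unfolding core_def by (intro sets_lebesgue_Times sets.Diff sets_cube)

lemma shell_disjoint: "z \<in> shell ij \<Longrightarrow> z \<in> shell kl \<Longrightarrow> ij = kl"
  by (cases ij; cases kl) (auto simp: shell_def dest: cube_shell_disjoint)

lemma mem_shell_ex: "fst z \<noteq> 0 \<Longrightarrow> snd z \<noteq> 0 \<Longrightarrow> \<exists>ij. z \<in> shell ij"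
  using mem_cube_shell_ex[of "fst z"] mem_cube_shell_ex[of "snd z"]
  unfolding shell_def by (metis fst_conv snd_conv mem_Times_iff)

lemma mem_core_ex:
  fixes z :: "(real^'a) \<times> (real^'b)"
  assumes "fst z \<noteq> 0" "snd z \<noteq> 0"
  shows "\<exists>n. z \<in> core n"
proof -
  obtain a b :: nat where "fst z \<in> cube (int a)" "snd z \<in> cube (int b)"
    using cball_subset_cube[of "norm (fst z)"] cball_subset_cube[of "norm (snd z)"] by blast
  moreover obtain c d :: nat where "fst z \<notin> cube (- int c - 1)" "snd z \<notin> cube (- int d - 1)"
    using cube_subset_ball[of "norm (fst z)"] cube_subset_ball[of "norm (snd z)"] assms by auto
  moreover define n where "n = max (max a b) (max c d)"
  moreover have "cube (int a) \<subseteq> (cube (int n) :: (real^'a) set)" "cube (int b) \<subseteq> (cube (int n) ::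
      (real^'b) set)"
    "cube (- int n - 1) \<subseteq> (cube (- int c - 1) :: (real^'a) set)"
    "cube (- int n - 1) \<subseteq> (cube (- int d - 1) :: (real^'b) set)"
    by (intro cube_mono; simp add: n_def)+
  ultimately have "z \<in> core n"
    unfolding core_def by (auto simp only: mem_Times_iff)
  then show ?thesis ..
qed

lemma core_mono: "m \<le> n \<Longrightarrow> core m \<subseteq> core n"
  unfolding core_def by (intro Sigma_mono Diff_mono cube_mono) auto

lemma core_subset_cube: "core n \<subseteq> cube (int n) \<times> cube (int n)"
  by (auto simp: core_def)

lemma cube_shell_index:
  assumes "x \<in> cube (int n)" "x \<notin> cube (- int n - 1)" "x \<in> cube_shell k"
  shows "k \<in> {- int n..int n}"
proof -
  have "\<not> k \<le> - int n - 1" "\<not> int n \<le> k - 1"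
    using assms cube_mono[of k "- int n - 1"] cube_mono[of "int n" "k - 1"]
    by (auto simp: cube_shell_def)
  then show ?thesis by simp
qed

lemma mem_core_shell:
  assumes "z \<in> core n" "z \<in> shell ij"
  shows "ij \<in> {- int n..int n} \<times> {- int n..int n}"
  using assms unfolding core_def shell_def mem_Times_iff by (auto dest!: cube_shell_index)

text \<open>Each coordinate subspace lies in a hyperplane, hence is null. The shells cover only its
  complement, which is why decompositions into shells hold almost everywhere.\<close>

lemma AE_punctured: "AE z in (lebesgue :: ((real^'n) \<times> (real^'m)) measure). fst z \<noteq> 0 \<and> snd z \<noteq> 0"
proof -
  \<comment> \<open>Index types are inhabited; any one coordinate of each factor gives a suitable
    hyperplane.\<close>
  obtain i :: 'n and j :: 'm where True by blast
  have "negligible {z :: (real^'n) \<times> (real^'m). (axis i 1, 0) \<bullet> z = 0}"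
    "negligible {z :: (real^'n) \<times> (real^'m). (0, axis j 1) \<bullet> z = 0}"
    by (intro negligible_hyperplane; simp add: prod_eq_iff axis_eq_0_iff)+
  then have "AE z in lebesgue. (axis i 1 :: real^'n, 0 :: real^'m) \<bullet> z \<noteq> 0"
    "AE z in lebesgue. (0 :: real^'n, axis j 1 :: real^'m) \<bullet> z \<noteq> 0"
    by (auto simp: negligible_iff_null_sets dest!: AE_not_in)
  then show ?thesis
    by eventually_elim (auto simp: inner_prod_def)
qed

lemma AE_core: "AE z in lebesgue. \<exists>n. z \<in> core n"
  using AE_punctured by eventually_elim (use mem_core_ex in blast)

text \<open>The inclusion is given for all large m, so that the two projections of a compact set can
  share one index.\<close>

lemma compact_subset_cube_Diff:
  assumes K': "compact K'" "(0::real^'c) \<notin> K'"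
  shows "\<exists>n::nat. \<forall>m\<ge>n. K' \<subseteq> cube (int m) - cube (- int m - 1)"
proof -
  obtain d where d: "0 < d" "\<And>x. x \<in> K' \<Longrightarrow> d \<le> norm x"
    using separate_point_closed[of K' 0] K' compact_imp_closed by auto
  obtain B where B: "\<And>x. x \<in> K' \<Longrightarrow> norm x \<le> B"
    using compact_imp_bounded[OF K'(1)] by (auto simp: bounded_iff)
  obtain a b :: nat where ab: "\<And>x :: real^'c. norm x \<le> B \<Longrightarrow> x \<in> cube (int a)"
    "\<And>x :: real^'c. x \<in> cube (- int b - 1) \<Longrightarrow> norm x < d"
    using cball_subset_cube[of B] cube_subset_ball[OF d(1)] by blast
  have "K' \<subseteq> cube (int m) - cube (- int m - 1)" if "max a b \<le> m" for m
  proof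
    fix x assume "x \<in> K'"
    then have "x \<in> cube (int a)" "x \<notin> cube (- int b - 1)"
      using ab(1)[OF B] ab(2)[of x] d(2)[of x] by auto
    then show "x \<in> cube (int m) - cube (- int m - 1)"
      using that cube_mono[of "int a" "int m"] cube_mono[of "- int m - 1" "- int b - 1"] by auto
  qed
  then show ?thesis by blast
qed

lemma compact_subset_core:
  assumes "compact K" "K \<subseteq> (- {0}) \<times> (- {0})"
  shows "\<exists>n. K \<subseteq> core n"
proof -
  have "compact (fst ` K)" "compact (snd ` K)"
    using assms(1) by (auto intro!: compact_continuous_image continuous_intros)
  moreover have "0 \<notin> fst ` K" "0 \<notin> snd ` K" using assms(2) by auto
  ultimately obtain a b where
      "\<forall>m\<ge>a. fst ` K \<subseteq> cube (int m) - cube (- int m - 1)"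
      "\<forall>m\<ge>b. snd ` K \<subseteq> cube (int m) - cube (- int m - 1)"
    using compact_subset_cube_Diff[of "fst ` K"] compact_subset_cube_Diff[of "snd ` K"] by blast
  then have "fst ` K \<subseteq> cube (int (max a b)) - cube (- int (max a b) - 1)"
     "snd ` K \<subseteq> cube (int (max a b)) - cube (- int (max a b) - 1)"
    using max.cobounded1 max.cobounded2 by blast+
  then have "K \<subseteq> core (max a b)"
    unfolding core_def by (intro subsetI) (simp only: mem_Times_iff image_subset_iff)
  then show ?thesis ..
qed

lemma nn_integral_count_space_single:
  "(\<And>y. y \<noteq> x \<Longrightarrow> f y = 0) \<Longrightarrow> (\<integral>\<^sup>+ y. f y \<partial>count_space UNIV) = f x"
  by (subst nn_integral_count_space'[of "{x}"]) auto

text \<open>Almost every point lies in exactly one shell, so h is the sum of its restrictions;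
  summation and integration are then interchanged.\<close>

lemma nn_integral_shells:
  assumes [measurable]: "h \<in> borel_measurable lebesgue"
  shows "(\<integral>\<^sup>+ z. h z \<partial>lebesgue)
      = (\<integral>\<^sup>+ ij. (\<integral>\<^sup>+ z. h z * indicator (shell ij) z \<partial>lebesgue) \<partial>count_space UNIV)"
proof -
  have "(\<integral>\<^sup>+ z. h z \<partial>lebesgue) =
      (\<integral>\<^sup>+ z. (\<integral>\<^sup>+ ij. h z * indicator (shell ij) z \<partial>count_space UNIV) \<partial>lebesgue)"
  proof (rule nn_integral_cong_AE, use AE_punctured in eventually_elim)
    case (elim z)
    then obtain ij where "z \<in> shell ij" using mem_shell_ex by blast
    moreover from this have "z \<notin> shell kl" if "kl \<noteq> ij" for kl using that shell_disjoint by blast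
    ultimately show ?case by (subst nn_integral_count_space_single[of ij]) auto
  qed
  also have "\<dots> = (\<integral>\<^sup>+ ij. (\<integral>\<^sup>+ z. h z * indicator (shell ij) z \<partial>lebesgue) \<partial>count_space UNIV)"
    by (rule nn_integral_count_space_nn_integral) auto
  finally show ?thesis .
qed

section \<open>Herz norms of functions with values in \<open>[0,\<infinity>]\<close>\<close>

definition weight :: "real \<Rightarrow> int \<times> int \<Rightarrow> ennreal" where
  "weight a ij = ennreal (2 powr (real_of_int (fst ij + snd ij) * a))"

lemma weight_minus: "weight a ij * weight (- a) ij = 1" "weight (- a) ij * weight a ij = 1"
  by (simp_all add: weight_def ennreal_mult[symmetric] powr_add[symmetric])

lemma weight_less_top: "weight a ij < top"
  by (simp add: weight_def)

lemma weight_neq_0: "weight a ij \<noteq> 0"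
  by (simp add: weight_def)

text \<open>The weight is inserted before the power s is taken, with exponent (i+j) a in place of
  (i+j) s a. The Herz norm thereby is literally an \<open>nnorm\<close> of a sequence of
  \<open>nnorm\<close> values.\<close>

definition eherz :: "real \<Rightarrow> real \<Rightarrow> real \<Rightarrow> ((real^'n) \<times> (real^'m) \<Rightarrow> ennreal) \<Rightarrow> ennreal" where
  "eherz a r s u = nnorm (count_space UNIV) s
     (\<lambda>ij. weight a ij * nnorm lebesgue r (\<lambda>z. u z * indicator (shell ij) z))"

lemma Lnorm_eq_nnorm: "Lnorm r f = nnorm lebesgue r (\<lambda>z. ennreal (norm (f z)))"
  by (simp add: Lnorm_def nnorm_def)

lemma herz_norm_eq:
  assumes "0 < s"
  shows "herz_norm a r s f = eherz a r s (\<lambda>z. ennreal (norm (f z)))"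
proof -
  have "(case ij of (i, j) \<Rightarrow> ennreal (2 powr (real_of_int (i + j) * s * a)) *
        epowr (Lnorm r (\<lambda>z. indicator (cube_shell i \<times> cube_shell j) z *\<^sub>R f z)) s) =
     epowr (weight a ij * nnorm lebesgue r (\<lambda>z. ennreal (norm (f z)) * indicator (shell ij) z)) s"
         for ij
  proof -
    have "epowr (weight a ij) s = ennreal (2 powr (real_of_int (fst ij + snd ij) * s * a))"
      by (simp add: weight_def powr_powr mult_ac)
    moreover have "ennreal (norm (indicator (shell ij) z *\<^sub>R f z))
        = ennreal (norm (f z)) * indicator (shell ij) z" for z
      by (simp add: indicator_def)
    ultimately show ?thesis
      by (simp add: split_beta epowr_mult Lnorm_eq_nnorm shell_def[symmetric])
  qed
  then show ?thesis
    unfolding herz_norm_def eherz_def nnorm_def[of "count_space UNIV"]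
    by (simp add: infsum_eq_nn_integral_count_space)
qed

lemma morrey_herz_norm_eq:
  assumes "0 < s"
  shows "morrey_herz_norm a l r s f =
     (SUP L1. SUP L2. ennreal (2 powr (- (real_of_int (L1 + L2) * l))) *
        eherz a r s (\<lambda>z. ennreal (norm (f z)) * indicator (cube L1 \<times> cube L2) z))"
proof -
  have "ennreal (norm (indicator E z *\<^sub>R f z)) = ennreal (norm (f z)) * indicator E z" for z E
    by (simp add: indicator_def)
  then show ?thesis
    unfolding morrey_herz_norm_def by (simp add: herz_norm_eq assms)
qed

lemma eherz_mono_AE:
  assumes "0 < r" "0 < s" "AE z in lebesgue. u z \<le> v z"
  shows "eherz a r s u \<le> eherz a r s v"
  unfolding eherz_def
proof (intro nnorm_mono[OF assms(2)] mult_left_mono nnorm_mono_AE[OF assms(1)])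
  show "AE z in lebesgue. u z * indicator (shell ij) z \<le> v z * indicator (shell ij) z" for ij
    using assms(3) by eventually_elim (rule mult_right_mono, auto)
qed simp

lemma eherz_mono:
  assumes "0 < r" "0 < s" "\<And>z. u z \<le> v z"
  shows "eherz a r s u \<le> eherz a r s v"
  using assms by (intro eherz_mono_AE) auto

lemma eherz_cmult:
  assumes "0 < r" "0 < s" and [measurable]: "u \<in> borel_measurable lebesgue"
  shows "eherz a r s (\<lambda>z. c * u z) = c * eherz a r s u"
  using assms(1,2)
  by (simp add: eherz_def mult.assoc nnorm_cmult mult.left_commute[of _ c])

lemma eherz_SUP:
  assumes "0 < r" "0 < s" and mono: "\<And>n z. u n z \<le> u (Suc n) z"
    and [measurable]: "\<And>n. u n \<in> borel_measurable lebesgue"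
  shows "eherz a r s (\<lambda>z. SUP n::nat. u n z) = (SUP n. eherz a r s (u n))"
proof -
  have "nnorm lebesgue r (\<lambda>z. (SUP n. u n z) * indicator (shell ij) z) =
      (SUP n. nnorm lebesgue r (\<lambda>z. u n z * indicator (shell ij) z))" for ij
    unfolding SUP_mult_right_ennreal using assms(1)
    by (intro nnorm_SUP) (auto intro!: mult_right_mono mono)
  then show ?thesis
    unfolding eherz_def
    using assms(1,2)
    by (subst nnorm_SUP[symmetric]) (auto simp: SUP_mult_left_ennreal intro!: mult_left_mono
        nnorm_mono mult_right_mono mono)
qed

lemma nnorm_shell_le_eherz:
  assumes "0 < r" "0 < s"
  shows "weight a ij * nnorm lebesgue r (\<lambda>z. u z * indicator (shell ij) z) \<le> eherz a r s u"
proof -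
  let ?d = "\<lambda>ij. weight a ij * nnorm lebesgue r (\<lambda>z. u z * indicator (shell ij) z)"
  have "epowr (?d ij) s = (\<integral>\<^sup>+ kl. epowr (?d kl) s * indicator {ij} kl \<partial>count_space UNIV)"
    by (subst nn_integral_count_space_single[of ij]) auto
  also have "\<dots> \<le> (\<integral>\<^sup>+ kl. epowr (?d kl) s \<partial>count_space UNIV)"
    by (intro nn_integral_mono) (auto simp: indicator_def)
  finally show ?thesis
    using assms by (simp add: eherz_def nnorm_def epowr_le_iff)
qed

lemma nnorm_shell_finite:
  assumes "0 < r" "0 < s" "eherz a r s u < top"
  shows "nnorm lebesgue r (\<lambda>z. u z * indicator (shell ij) z) < top"
proof -
  have "weight a ij * nnorm lebesgue r (\<lambda>z. u z * indicator (shell ij) z) < top"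
    using nnorm_shell_le_eherz[OF assms(1,2)] assms(3) by (rule le_less_trans)
  then show ?thesis
    using weight_neq_0[of a ij] by (auto simp: ennreal_mult_eq_top_iff less_top[symmetric])
qed

text \<open>Dominated convergence is used twice: on every shell with dominating function v, and then
  over the index pairs, with the weighted shell norms of v as dominating sequence.\<close>

lemma eherz_tendsto_0:
  assumes r: "0 < r" "0 < s"
    and [measurable]: "\<And>n. u n \<in> borel_measurable lebesgue" "v \<in> borel_measurable lebesgue"
    and le: "\<And>n. AE z in lebesgue. u n z \<le> v z" and fin: "eherz a r s v < top"
    and lim: "AE z in lebesgue. (\<lambda>n. u n z) \<longlonglongrightarrow> 0"
  shows "(\<lambda>n. eherz a r s (u n)) \<longlonglongrightarrow> 0"
  unfolding eherz_def
proof (rule nnorm_tendsto_0[where v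
    = "\<lambda>ij. weight a ij * nnorm lebesgue r (\<lambda>z. v z * indicator (shell ij) z)"])
  have le': "AE z in lebesgue. u n z * indicator (shell ij) z
      \<le> v z * indicator (shell ij) z" for ij n
    using le[of n] by eventually_elim (rule mult_right_mono, auto)
  show "AE ij in count_space UNIV. weight a ij * nnorm lebesgue r (\<lambda>z. u n z * indicator (shell
      ij) z) \<le>
       weight a ij * nnorm lebesgue r (\<lambda>z. v z * indicator (shell ij) z)" for n
    by (intro AE_I2 mult_left_mono nnorm_mono_AE[OF r(1)] le') simp
  show "AE ij in count_space UNIV. (\<lambda>n. weight a ij * nnorm lebesgue r (\<lambda>z. u n z * indicator
      (shell ij) z)) \<longlonglongrightarrow> 0"
  proof (rule AE_I2)
    fix ij
    have "(\<lambda>n. nnorm lebesgue r (\<lambda>z. u n z * indicator (shell ij) z)) \<longlonglongrightarrow> 0"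
    proof (rule nnorm_tendsto_0[OF _ _ _ le'])
      show "AE z in lebesgue. (\<lambda>n. u n z * indicator (shell ij) z) \<longlonglongrightarrow> 0"
        using lim by eventually_elim (auto simp: indicator_def)
    qed (use r fin nnorm_shell_finite[OF r fin] in auto)
    then have "(\<lambda>n. weight a ij * nnorm lebesgue r (\<lambda>z. u n z * indicator (shell ij) z)) \<longlonglongrightarrow> weight
        a ij * 0"
      by (intro ennreal_tendsto_cmult weight_less_top)
    then show "(\<lambda>n. weight a ij * nnorm lebesgue r (\<lambda>z. u n z * indicator (shell ij) z)) \<longlonglongrightarrow> 0"
        by simp
  qed
qed (use r fin in \<open>auto simp: eherz_def\<close>)

text \<open>The weights with exponents a and - a multiply to 1 on every shell and can be inserted
  between the two applications of Hoelder. This is the origin of the sign change of alpha in the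
  dual space.\<close>

lemma eherz_Holder:
  assumes p: "1 < p" "1 / p + 1 / p' = 1" and q: "1 < q" "1 / q + 1 / q' = 1"
    and [measurable]: "u \<in> borel_measurable lebesgue" "v \<in> borel_measurable lebesgue"
  shows "(\<integral>\<^sup>+ z. u z * v z \<partial>lebesgue) \<le> eherz a p q u * eherz (- a) p' q' v"
proof -
  let ?N = "\<lambda>r u ij. nnorm lebesgue r (\<lambda>z. u z * indicator (shell ij) z)"
  have "(\<integral>\<^sup>+ z. u z * v z \<partial>lebesgue) =
      (\<integral>\<^sup>+ ij. (\<integral>\<^sup>+ z. (u z * indicator (shell ij) z) * (v z * indicator (shell ij) z) \<partial>lebesgue)
          \<partial>count_space UNIV)"
    by (subst nn_integral_shells) (auto intro!: nn_integral_cong simp: indicator_def)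
  also have "\<dots> \<le> (\<integral>\<^sup>+ ij. ?N p u ij * ?N p' v ij \<partial>count_space UNIV)"
    by (intro nn_integral_mono nnorm_Holder p) auto
  also have "\<dots> = (\<integral>\<^sup>+ ij. (weight a ij * ?N p u ij) * (weight (- a) ij * ?N p' v ij) \<partial>count_space
      UNIV)"
  proof (intro nn_integral_cong)
    fix ij
    have "(weight a ij * ?N p u ij) * (weight (- a) ij * ?N p' v ij)
        = (weight a ij * weight (- a) ij) * (?N p u ij * ?N p' v ij)"
      by (simp only: mult_ac)
    then show "?N p u ij * ?N p' v ij = (weight a ij * ?N p u ij) * (weight (- a) ij * ?N p' v ij)"
      by (simp add: weight_minus)
  qed
  also have "\<dots> \<le> eherz a p q u * eherz (- a) p' q' v"
    unfolding eherz_def by (intro nnorm_Holder q) auto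
  finally show ?thesis .
qed

text \<open>An extremal is chosen on every shell for the inner norm and one sequence for the outer
  norm; disjointness of the shells allows the products to be glued.\<close>

lemma eherz_attained:
  assumes p: "1 < p" "1 / p + 1 / p' = 1" and q: "1 < q" "1 / q + 1 / q' = 1"
    and [measurable]: "u \<in> borel_measurable lebesgue" and fin: "eherz (- a) p' q' u < top"
  obtains v where "v \<in> borel_measurable lebesgue" "eherz a p q v \<le> 1"
    "(\<integral>\<^sup>+ z. u z * v z \<partial>lebesgue) = eherz (- a) p' q' u"
proof -
  note p' = conjugate_exponent(1)[OF p] and q' = conjugate_exponent(1)[OF q]
  let ?N = "\<lambda>r u ij. nnorm lebesgue r (\<lambda>z. u z * indicator (shell ij) z)"
  let ?d = "\<lambda>ij. weight (- a) ij * ?N p' u ij"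
  have "\<exists>v. v \<in> borel_measurable lebesgue \<and> nnorm lebesgue p v \<le> 1 \<and>
      (\<integral>\<^sup>+ z. (u z * indicator (shell ij) z) * v z \<partial>lebesgue) = ?N p' u ij" for ij
  proof -
    have [measurable]: "(\<lambda>z. u z * indicator (shell ij) z) \<in> borel_measurable lebesgue"
        by measurable
    have "?N p' u ij < top" using nnorm_shell_finite[OF _ _ fin] p' q' by simp
    then show ?thesis
      by (rule nnorm_attained[OF p, of "\<lambda>z. u z * indicator (shell ij) z" lebesgue, rotated])
          (blast, simp)
  qed
  then have "\<forall>ij. \<exists>v. v \<in> borel_measurable lebesgue \<and> nnorm lebesgue p v \<le> 1 \<and>
      (\<integral>\<^sup>+ z. (u z * indicator (shell ij) z) * v z \<partial>lebesgue) = ?N p' u ij" ..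
  from choice[OF this] obtain v where [measurable]: "\<And>ij. v ij \<in> borel_measurable lebesgue"
    and v: "\<And>ij. nnorm lebesgue p (v ij) \<le> 1"
      "\<And>ij. (\<integral>\<^sup>+ z. (u z * indicator (shell ij) z) * v ij z \<partial>lebesgue) = ?N p' u ij"
    by blast
  obtain e where e: "nnorm (count_space UNIV) q e \<le> 1"
     "(\<integral>\<^sup>+ ij. ?d ij * e ij \<partial>count_space UNIV) = eherz (- a) p' q' u"
    using nnorm_attained[OF q, of ?d "count_space UNIV"] fin unfolding eherz_def by auto
  \<comment> \<open>At each point at most one term is nonzero. The weight with exponent - a cancels
    the weight in the Herz norm of w, leaving at most the sequence \<open>e\<close>; in the pairing
    with u it rebuilds the sequence to which \<open>e\<close> is extremal.\<close>
  define w where "w z = (\<integral>\<^sup>+ ij. weight (- a) ij * e ij * v ij z * indicator (shell ij) z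
      \<partial>count_space UNIV)" for z
  have w: "w z * indicator (shell ij) z
      = weight (- a) ij * e ij * (v ij z * indicator (shell ij) z)" for z ij
  proof (cases "z \<in> shell ij")
    case True
    then have "z \<notin> shell kl" if "kl \<noteq> ij" for kl using that shell_disjoint by blast
    then have "w z = weight (- a) ij * e ij * v ij z * indicator (shell ij) z"
      unfolding w_def by (intro nn_integral_count_space_single) auto
    then show ?thesis using True by simp
  qed simp
  show ?thesis
  proof (rule that[of w])
    interpret sigma_finite_measure "count_space (UNIV :: (int \<times> int) set)"
      by (rule sigma_finite_measure_count_space_countable) simp
    show [measurable]: "w \<in> borel_measurable lebesgue"
    proof -
      have *: "(\<lambda>(z, ij). weight (- a) ij * e ij * v ij z * indicator (shell ij) z)
          \<in> borel_measurable (lebesgue \<Otimes>\<^sub>M count_space UNIV)"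
        unfolding split_beta
        by (rule measurable_compose_countable'[where I = UNIV and g = snd
            and f = "\<lambda>ij x. weight (- a) ij * e ij * v ij (fst x) * indicator (shell ij) (fst
                x)"]) auto
      show ?thesis unfolding w_def[abs_def]
        using borel_measurable_nn_integral[OF *] by simp
    qed
    have "weight a ij * ?N p w ij \<le> e ij" for ij
    proof -
      have "?N p w ij = weight (- a) ij * e ij * ?N p (v ij) ij"
        using p by (simp add: w nnorm_cmult)
      also have "?N p (v ij) ij \<le> nnorm lebesgue p (v ij)"
        using p by (intro nnorm_mono) (auto simp: indicator_def)
      also have "\<dots> \<le> 1" by (rule v)
      finally have "weight a ij * ?N p w ij \<le> weight a ij * (weight (- a) ij * e ij)"
        by (simp add: mult_left_mono)
      then show ?thesis by (simp add: mult.assoc[symmetric] weight_minus)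
    qed
    then have "eherz a p q w \<le> nnorm (count_space UNIV) q e"
      unfolding eherz_def using q by (intro nnorm_mono) auto
    then show "eherz a p q w \<le> 1" using e(1) by simp
    have "(\<integral>\<^sup>+ z. u z * w z \<partial>lebesgue) =
       (\<integral>\<^sup>+ ij. (\<integral>\<^sup>+ z. u z * (w z * indicator (shell ij) z) \<partial>lebesgue) \<partial>count_space UNIV)"
      by (subst nn_integral_shells) (simp_all add: mult.assoc)
    also have "\<dots> = (\<integral>\<^sup>+ ij. (\<integral>\<^sup>+ z. weight (- a) ij * e ij * ((u z * indicator (shell ij) z) * v
        ij z) \<partial>lebesgue) \<partial>count_space UNIV)"
      unfolding w by (simp only: mult_ac)
    also have "\<dots> = (\<integral>\<^sup>+ ij. weight (- a) ij * e ij * ?N p' u ij \<partial>count_space UNIV)"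
      by (subst nn_integral_cmult) (simp_all add: v)
    also have "\<dots> = eherz (- a) p' q' u"
      unfolding e(2)[symmetric] by (simp only: mult_ac)
    finally show "(\<integral>\<^sup>+ z. u z * w z \<partial>lebesgue) = eherz (- a) p' q' u" .
  qed
qed

text \<open>The constant is the sequence norm of the weights over the finite square of indices whose
  shells can meet \<open>core n\<close>. It is chosen before \<open>M\<close>, \<open>A\<close> and
  \<open>u\<close>, and this uniformity in A later gives the power bound for Radon-Nikodym.\<close>

lemma eherz_core_bound:
  assumes r: "0 < r" "0 < s"
  obtains c where "0 \<le> c"
    "\<And>M A (u :: (real^'n) \<times> (real^'m) \<Rightarrow> ennreal). A \<in> sets lebesgue \<Longrightarrow> A \<subseteq> core n \<Longrightarrow>
        (\<And>z. u z \<le> M * indicator A z) \<Longrightarrow>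
       eherz a r s u \<le> ennreal c * (M * epowr (emeasure lebesgue A) (1 / r))"
proof -
  define F where "F = {- int n..int n} \<times> {- int n..int n}"
  define c where "c = nnorm (count_space UNIV) s (\<lambda>ij. weight a ij * indicator F ij)"
  have "finite F" by (simp add: F_def)
  then have "(\<integral>\<^sup>+ ij. epowr (weight a ij * indicator F ij) s \<partial>count_space UNIV) =
     (\<Sum>ij\<in>F. epowr (weight a ij * indicator F ij) s)"
    by (intro nn_integral_count_space') auto
  also have "\<dots> < top"
    using \<open>finite F\<close> by (auto simp: less_top[symmetric] weight_def)
  finally have "c < top" by (simp add: c_def nnorm_def)
  have "eherz a r s u \<le> c * (M * epowr (emeasure lebesgue A) (1 / r))"
    if A[measurable]: "A \<in> sets lebesgue" and sub: "A \<subseteq> core n" and u: "\<And>z. u z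
        \<le> M * indicator A z" for M A and u :: "(real^'n) \<times> (real^'m) \<Rightarrow> ennreal"
  proof -
    let ?m = "M * epowr (emeasure lebesgue A) (1 / r)"
    have "eherz a r s u \<le> nnorm (count_space UNIV) s (\<lambda>ij. ?m * (weight a ij * indicator F ij))"
      unfolding eherz_def
    proof (rule nnorm_mono[OF r(2)])
      fix ij
      have "nnorm lebesgue r (\<lambda>z. u z * indicator (shell ij) z)
          \<le> nnorm lebesgue r (\<lambda>z. (indicator F ij * M) * indicator A z)"
      proof (rule nnorm_mono[OF r(1)])
        fix z
        show "u z * indicator (shell ij) z \<le> indicator F ij * M * indicator A z"
          using u[of z] sub mem_core_shell[of z n ij]
              by (cases "z \<in> A") (auto simp: F_def indicator_def)
      qed
      also have "\<dots> = indicator F ij * M * epowr (emeasure lebesgue A) (1 / r)"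
      proof -
        have "epowr (indicator A z) r = indicator A z" for z by (simp add: indicator_def)
        then show ?thesis
          using r by (subst nnorm_cmult) (simp_all add: nnorm_def)
      qed
      finally have "weight a ij * nnorm lebesgue r (\<lambda>z. u z * indicator (shell ij) z)
          \<le> weight a ij * (indicator F ij * M * epowr (emeasure lebesgue A) (1 / r))"
        by (rule mult_left_mono) simp
      then show "weight a ij * nnorm lebesgue r (\<lambda>z. u z * indicator (shell ij) z)
          \<le> ?m * (weight a ij * indicator F ij)"
        by (simp only: mult_ac)
    qed
    also have "\<dots> = c * ?m"
      using r by (subst nnorm_cmult) (simp_all add: c_def mult.commute)
    finally show ?thesis .
  qed
  moreover have "c = ennreal (enn2real c)" using \<open>c < top\<close> by simp
  ultimately show ?thesis using that[of "enn2real c"] by simp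
qed

section \<open>Densities of additive set functions\<close>

text \<open>The power bound supplies countable additivity: along sets decreasing to the empty set it
  forces nu to 0, and for a finite nonnegative additive set function this suffices. It also makes
  M-null sets null for nu.\<close>

lemma additive_Radon_Nikodym_nonneg:
  fixes \<nu> :: "'a set \<Rightarrow> real"
  assumes "finite_measure M"
    and add: "\<And>A B. A \<in> sets M \<Longrightarrow> B \<in> sets M \<Longrightarrow> A \<inter> B = {} \<Longrightarrow> \<nu> (A \<union> B) = \<nu> A + \<nu> B"
    and bound: "\<And>A. A \<in> sets M \<Longrightarrow> \<nu> A \<le> C * measure M A powr t" and t: "0 < t"
    and nonneg: "\<And>A. A \<in> sets M \<Longrightarrow> 0 \<le> \<nu> A"
  shows "\<exists>f. integrable M f \<and> (\<forall>A\<in>sets M. \<nu> A = (\<integral>x. indicator A x *\<^sub>R f x \<partial>M))"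
proof -
  interpret finite_measure M by fact
  have empty: "\<nu> {} = 0" using add[of "{}" "{}"] by simp
  define N where "N = measure_of (space M) (sets M) (\<lambda>A. ennreal (\<nu> A))"
  have ca: "countably_additive (sets M) (\<lambda>A. ennreal (\<nu> A))"
  proof (rule sets.empty_continuous_imp_countably_additive)
    show "positive (sets M) (\<lambda>A. ennreal (\<nu> A))"
      by (simp add: positive_def empty)
    show "additive (sets M) (\<lambda>A. ennreal (\<nu> A))"
      using add nonneg by (auto simp: additive_def ennreal_plus)
    fix A :: "nat \<Rightarrow> 'a set" assume A: "range A \<subseteq> sets M" "decseq A" "(\<Inter>i. A i) = {}"
    have "(\<lambda>i. measure M (A i)) \<longlonglongrightarrow> measure M (\<Inter>i. A i)"
      using A by (intro finite_Lim_measure_decseq) auto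
    then have "(\<lambda>i. measure M (A i)) \<longlonglongrightarrow> 0" using A by simp
    then have "(\<lambda>i. C * measure M (A i) powr t) \<longlonglongrightarrow> C * 0"
      using t by (intro tendsto_mult tendsto_const tendsto_zero_powrI[where b = t]) auto
    then have lim: "(\<lambda>i. C * measure M (A i) powr t) \<longlonglongrightarrow> 0" by simp
    have "(\<lambda>i. \<nu> (A i)) \<longlonglongrightarrow> 0"
      by (rule tendsto_sandwich[of "\<lambda>i. 0", OF _ _ tendsto_const lim]) (use A bound nonneg in
          \<open>auto intro!: always_eventually\<close>)
    then show "(\<lambda>i. ennreal (\<nu> (A i))) \<longlonglongrightarrow> 0"
      using tendsto_ennrealI[of _ 0] by simp
  qed simp
  have sets_N [simp]: "sets N = sets M"
    by (simp add: N_def sets.sets_measure_of_eq)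
  have N: "emeasure N A = ennreal (\<nu> A)" if "A \<in> sets M" for A
    using that ca unfolding N_def
    by (subst emeasure_measure_of[where \<Omega> = "space M" and A = "sets M"])
      (auto simp: positive_def empty sets.space_closed sets.sigma_sets_eq)
  have "absolutely_continuous M N"
    unfolding absolutely_continuous_def
  proof
    fix A assume "A \<in> null_sets M"
    then have A: "A \<in> sets M" "measure M A = 0" by (auto simp: measure_def)
    then have "\<nu> A = 0" using bound[of A] nonneg[of A] t by simp
    then show "A \<in> null_sets N" using A N by (simp add: null_sets_def)
  qed
  then obtain f where [measurable]: "f \<in> borel_measurable M" and f: "density M f = N"
    using Radon_Nikodym[of N] by auto
  have int: "(\<integral>\<^sup>+x. f x * indicator A x \<partial>M) = ennreal (\<nu> A)" if "A \<in> sets M" for A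
    using that N[OF that] by (simp add: f[symmetric] emeasure_density)
  have "(\<integral>\<^sup>+x. f x \<partial>M) = (\<integral>\<^sup>+x. f x * indicator (space M) x \<partial>M)"
    by (intro nn_integral_cong) simp
  then have fin: "(\<integral>\<^sup>+x. f x \<partial>M) \<noteq> \<infinity>" using int[of "space M"] by simp
  then have AEfin: "AE x in M. f x \<noteq> \<infinity>" by (intro nn_integral_PInf_AE) auto
  show ?thesis
  \<comment> \<open>The density is finite almost everywhere because nu of the whole space is finite,
    so \<open>enn2real\<close> changes it on a null set only.\<close>
  proof (intro exI[of _ "\<lambda>x. enn2real (f x)"] conjI ballI)
    have "(\<integral>\<^sup>+x. ennreal (norm (enn2real (f x))) \<partial>M) = (\<integral>\<^sup>+x. f x \<partial>M)"
      using AEfin by (intro nn_integral_cong_AE) (auto elim!: eventually_mono simp: less_top)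
    then show "integrable M (\<lambda>x. enn2real (f x))"
      using fin by (intro integrableI_bounded) (auto simp: less_top)
    fix A assume A[measurable]: "A \<in> sets M"
    have "(\<integral>x. indicator A x *\<^sub>R enn2real (f x) \<partial>M)
        = enn2real (\<integral>\<^sup>+x. ennreal (indicator A x *\<^sub>R enn2real (f x)) \<partial>M)"
      by (rule integral_eq_nn_integral) auto
    also have "(\<integral>\<^sup>+x. ennreal (indicator A x *\<^sub>R enn2real (f x)) \<partial>M)
        = (\<integral>\<^sup>+x. f x * indicator A x \<partial>M)"
      using AEfin by (intro nn_integral_cong_AE) (auto elim!: eventually_mono simp: less_top
          indicator_def)
    finally show "\<nu> A = (\<integral>x. indicator A x *\<^sub>R enn2real (f x) \<partial>M)"
      using int[OF A] nonneg[OF A] by simp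
  qed
qed

text \<open>Jordan decomposition: \<open>P\<close>, the supremum of nu over measurable subsets, is
  the positive variation. Both \<open>P\<close> and \<open>P\<close> - nu are nonnegative, additive
  and power bounded, and the density is the difference of theirs.\<close>

lemma additive_Radon_Nikodym_real:
  fixes \<nu> :: "'a set \<Rightarrow> real"
  assumes "finite_measure M"
    and add: "\<And>A B. A \<in> sets M \<Longrightarrow> B \<in> sets M \<Longrightarrow> A \<inter> B = {} \<Longrightarrow> \<nu> (A \<union> B) = \<nu> A + \<nu> B"
    and bound: "\<And>A. A \<in> sets M \<Longrightarrow> \<bar>\<nu> A\<bar> \<le> C * measure M A powr t" and t: "0 < t" and C: "0 \<le> C"
  shows "\<exists>f. integrable M f \<and> (\<forall>A\<in>sets M. \<nu> A = (\<integral>x. indicator A x *\<^sub>R f x \<partial>M))"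
proof -
  interpret finite_measure M by fact
  have empty: "\<nu> {} = 0" using add[of "{}" "{}"] by simp
  define S where "S A = \<nu> ` {B \<in> sets M. B \<subseteq> A}" for A
  define P where "P A = Sup (S A)" for A
  have le: "\<nu> B \<le> C * measure M A powr t" if "B \<in> sets M" "B \<subseteq> A" "A \<in> sets M" for A B
  proof -
    have "\<nu> B \<le> C * measure M B powr t" using bound[OF that(1)] by simp
    also have "\<dots> \<le> C * measure M A powr t"
      using C t that by (intro mult_left_mono powr_mono2 finite_measure_mono) auto
    finally show ?thesis .
  qed
  have bdd: "bdd_above (S A)" if "A \<in> sets M" for A
    using le that by (intro bdd_aboveI[of _ "C * measure M A powr t"]) (auto simp: S_def)
  have mem: "\<nu> B \<in> S A" if "B \<in> sets M" "B \<subseteq> A" for A B using that by (auto simp: S_def)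
  have ne: "S A \<noteq> {}" for A using mem[of "{}" A] by auto
  have upper: "\<nu> B \<le> P A" if "B \<in> sets M" "B \<subseteq> A" "A \<in> sets M" for A B
    unfolding P_def using that by (intro cSup_upper mem bdd)
  have P_add: "P (A \<union> B) = P A + P B" if AB: "A \<in> sets M" "B \<in> sets M" "A \<inter> B = {}" for A B
  proof (rule antisym)
    show "P (A \<union> B) \<le> P A + P B"
      unfolding P_def[of "A \<union> B"]
    proof (rule cSup_least[OF ne])
      fix x assume "x \<in> S (A \<union> B)"
      then obtain D where D: "D \<in> sets M" "D \<subseteq> A \<union> B" "x = \<nu> D" by (auto simp: S_def)
      have "\<nu> D = \<nu> ((D \<inter> A) \<union> (D \<inter> B))" using D by (intro arg_cong[where f = \<nu>]) auto
      also have "\<dots> = \<nu> (D \<inter> A) + \<nu> (D \<inter> B)" using D AB by (intro add) auto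
      also have "\<dots> \<le> P A + P B" using D AB by (intro add_mono upper) auto
      finally show "x \<le> P A + P B" using D by simp
    qed
    have "\<nu> D + \<nu> E \<le> P (A \<union> B)" if "D \<in> sets M" "D \<subseteq> A" "E \<in> sets M" "E \<subseteq> B" for D E
    proof -
      have "\<nu> D + \<nu> E = \<nu> (D \<union> E)" using that AB by (intro add[symmetric]) auto
      also have "\<dots> \<le> P (A \<union> B)" using that AB by (intro upper) auto
      finally show ?thesis .
    qed
    \<comment> \<open>The two suprema are taken one after the other, first over subsets of A with E
      fixed and then over subsets of B.\<close>
    then have "x \<le> P (A \<union> B) - \<nu> E" if "x \<in> S A" "E \<in> sets M" "E \<subseteq> B" for x E
      using that by (force simp: S_def)
    then have "P A \<le> P (A \<union> B) - \<nu> E" if "E \<in> sets M" "E \<subseteq> B" for E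
      unfolding P_def[of A] using that by (intro cSup_least ne)
    then have "x \<le> P (A \<union> B) - P A" if "x \<in> S B" for x
      using that by (force simp: S_def)
    then have "P B \<le> P (A \<union> B) - P A"
      unfolding P_def[of B] by (intro cSup_least ne)
    then show "P A + P B \<le> P (A \<union> B)" by simp
  qed
  have P_bound: "P A \<le> C * measure M A powr t" if "A \<in> sets M" for A
    unfolding P_def using le that by (intro cSup_least[OF ne]) (auto simp: S_def)
  have "\<exists>f. integrable M f \<and> (\<forall>A\<in>sets M. P A = (\<integral>x. indicator A x *\<^sub>R f x \<partial>M))"
    using \<open>finite_measure M\<close> P_add P_bound t
    by (rule additive_Radon_Nikodym_nonneg) (use upper[of "{}"] empty in auto)
  then obtain f where f: "integrable M f" "\<And>A. A \<in> sets M \<Longrightarrow> P A = (\<integral>x. indicator A x *\<^sub>R f x \<partial>M)"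
    by blast
  have "\<exists>f. integrable M f \<and> (\<forall>A\<in>sets M. P A - \<nu> A = (\<integral>x. indicator A x *\<^sub>R f x \<partial>M))"
    using \<open>finite_measure M\<close> _ _ t
  proof (rule additive_Radon_Nikodym_nonneg)
    show "P (A \<union> B) - \<nu> (A \<union> B) = P A - \<nu> A + (P B - \<nu> B)" if "A \<in> sets M" "B \<in> sets M" "A \<inter> B
        = {}" for A B
      using that by (simp add: P_add add)
    \<comment> \<open>Both P A and - nu A are at most C times the power of the measure.\<close>
    show "P A - \<nu> A \<le> (2 * C) * measure M A powr t" if "A \<in> sets M" for A
      using P_bound[OF that] bound[OF that] by (auto simp: abs_le_iff)
    show "0 \<le> P A - \<nu> A" if "A \<in> sets M" for A
      using upper[of A A] that by simp
  qed
  then obtain g where g: "integrable M g" "\<And>A. A \<in> sets M \<Longrightarrow>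
      P A - \<nu> A = (\<integral>x. indicator A x *\<^sub>R g x \<partial>M)"
    by blast
  show ?thesis
  proof (intro exI[of _ "\<lambda>x. f x - g x"] conjI ballI)
    fix A assume A: "A \<in> sets M"
    have "integrable M (\<lambda>x. indicator A x *\<^sub>R f x)" "integrable M (\<lambda>x. indicator A x *\<^sub>R g x)"
      using integrable_mult_indicator[OF A f(1)] integrable_mult_indicator[OF A g(1)] .
    then show "\<nu> A = (\<integral>x. indicator A x *\<^sub>R (f x - g x) \<partial>M)"
      using f(2)[OF A] g(2)[OF A] by (simp add: scaleR_diff_right del: real_scaleR_def)
  qed (use f g in auto)
qed

text \<open>Coordinates with respect to \<open>Basis\<close> reduce this to the real case, since a
  coordinate never exceeds the norm. It covers real and complex scalars at once.\<close>

lemma additive_Radon_Nikodym: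
  fixes \<nu> :: "'a set \<Rightarrow> 'b::euclidean_space"
  assumes "finite_measure M"
    and add: "\<And>A B. A \<in> sets M \<Longrightarrow> B \<in> sets M \<Longrightarrow> A \<inter> B = {} \<Longrightarrow> \<nu> (A \<union> B) = \<nu> A + \<nu> B"
    and bound: "\<And>A. A \<in> sets M \<Longrightarrow> norm (\<nu> A) \<le> C * measure M A powr t" and t: "0 < t" and C: "0 \<le> C"
  shows "\<exists>f. integrable M f \<and> (\<forall>A\<in>sets M. \<nu> A = (\<integral>x. indicator A x *\<^sub>R f x \<partial>M))"
proof -
  have "\<exists>f. integrable M f \<and> (\<forall>A\<in>sets M. \<nu> A \<bullet> b
      = (\<integral>x. indicator A x *\<^sub>R f x \<partial>M))" if b: "b \<in> Basis" for b
    using \<open>finite_measure M\<close> _ _ t C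
  proof (rule additive_Radon_Nikodym_real)
    show "\<bar>\<nu> A \<bullet> b\<bar> \<le> C * measure M A powr t" if "A \<in> sets M" for A
      using Basis_le_norm[OF b, of "\<nu> A"] bound[OF that] by simp
  qed (simp add: add inner_add_left)
  then have "\<forall>b\<in>Basis. \<exists>f. integrable M f \<and> (\<forall>A\<in>sets M. \<nu> A \<bullet> b
      = (\<integral>x. indicator A x *\<^sub>R f x \<partial>M))" ..
  from bchoice[OF this] obtain f where f: "\<And>b. b \<in> Basis \<Longrightarrow> integrable M (f b)"
    "\<And>b A. b \<in> Basis \<Longrightarrow> A \<in> sets M \<Longrightarrow> \<nu> A \<bullet> b = (\<integral>x. indicator A x *\<^sub>R f b x \<partial>M)"
    by blast
  show ?thesis
  proof (intro exI[of _ "\<lambda>x. \<Sum>b\<in>Basis. f b x *\<^sub>R b"] conjI ballI)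
    show "integrable M (\<lambda>x. \<Sum>b\<in>Basis. f b x *\<^sub>R b)" using f by auto
    fix A assume A: "A \<in> sets M"
    have int: "integrable M (\<lambda>x. indicator A x *\<^sub>R f b x)" if "b \<in> Basis" for b
      by (rule integrable_mult_indicator[OF A f(1)[OF that]])
    have "(\<integral>x. indicator A x *\<^sub>R (\<Sum>b\<in>Basis. f b x *\<^sub>R b) \<partial>M)
        = (\<integral>x. (\<Sum>b\<in>Basis. (indicator A x *\<^sub>R f b x) *\<^sub>R b) \<partial>M)"
      by (simp add: scaleR_sum_right)
    also have "\<dots> = (\<Sum>b\<in>Basis. (\<integral>x. indicator A x *\<^sub>R f b x \<partial>M) *\<^sub>R b)"
      using int by (subst Bochner_Integration.integral_sum) (auto simp del: real_scaleR_def)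
    also have "\<dots> = \<nu> A"
      using A by (simp add: f(2)[symmetric] euclidean_representation del: real_scaleR_def)
    finally show "\<nu> A = (\<integral>x. indicator A x *\<^sub>R (\<Sum>b\<in>Basis. f b x *\<^sub>R b) \<partial>M)" by simp
  qed
qed

section \<open>Pairing with blocks\<close>

text \<open>Passes from estimates for individual block representations to the infimum that defines
  the block norm. The case m = 0 is separate because division by m is used otherwise.\<close>

lemma le_Inf_mult_ennreal:
  assumes "\<And>c. c \<in> S \<Longrightarrow> x \<le> m * c" "m < top" "S \<noteq> {}"
  shows "x \<le> m * Inf (S :: ennreal set)"
proof (cases "m = 0")
  case True
  then show ?thesis using assms by force
next
  case False
  have "x / m \<le> Inf S"
    using assms False by (intro Inf_greatest divide_le_posI_ennreal) (auto simp:
        zero_less_iff_neq_zero)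
  then have "m * (x / m) \<le> m * Inf S" by (rule mult_left_mono) simp
  also have "m * (x / m) = x"
    using False assms(2) by (metis ennreal_times_divide less_top mult.commute
        mult_divide_eq_ennreal)
  finally show ?thesis .
qed

text \<open>The right-hand side may be infinite, so series that converge only conditionally are
  covered.\<close>

lemma norm_sums_le_suminf:
  assumes "f sums x"
  shows "ennreal (norm x) \<le> (\<Sum>n. ennreal (norm (f n)))"
proof (rule LIMSEQ_le_const2)
  show "(\<lambda>n. ennreal (norm (\<Sum>k<n. f k))) \<longlonglongrightarrow> ennreal (norm x)"
    using assms unfolding sums_def by (intro tendsto_ennrealI tendsto_norm)
  have "ennreal (norm (\<Sum>k<n. f k)) \<le> (\<Sum>k. ennreal (norm (f k)))" for n
  proof -
    have "ennreal (norm (\<Sum>k<n. f k)) \<le> ennreal (\<Sum>k<n. norm (f k))"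
      by (intro ennreal_leI norm_sum)
    also have "\<dots> = (\<Sum>k<n. ennreal (norm (f k)))" by simp
    also have "\<dots> \<le> (\<Sum>k. ennreal (norm (f k)))"
      by (intro sum_le_suminf) auto
    finally show ?thesis .
  qed
  then show "\<exists>N. \<forall>n\<ge>N. ennreal (norm (\<Sum>k<n. f k)) \<le> (\<Sum>k. ennreal (norm (f k)))" by blast
qed

lemma Lnorm_1: "Lnorm 1 f = (\<integral>\<^sup>+ z. ennreal (norm (f z)) \<partial>lebesgue)"
  by (simp add: Lnorm_eq_nnorm nnorm_def)

lemma emeasure_core_finite: "emeasure lebesgue (core n) < top"
proof -
  have "bounded (core n)"
    using bounded_subset[OF bounded_Times[OF bounded_cube bounded_cube] core_subset_cube] .
  then have "core n \<in> lmeasurable"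
    by (intro bounded_set_imp_lmeasurable sets_core)
  then show ?thesis by (auto simp: fmeasurable_def)
qed

locale herz_duality =
  fixes \<alpha> lam p q p' q' :: real
  assumes p: "1 < p" "1 / p + 1 / p' = 1" and q: "1 < q" "1 / q + 1 / q' = 1"
    and lam: "0 < lam"
begin

section \<open>Blocks against the Morrey-Herz norm\<close>

lemma exponents: "0 < p" "0 < q" "0 < p'" "0 < q'" "1 < p'" "1 < q'"
  using p q conjugate_exponent(1)[OF p] conjugate_exponent(1)[OF q] by auto

lemma eherz_cube_le_morrey:
  "ennreal (2 powr (- (real_of_int (L1 + L2) * lam))) *
     eherz (- \<alpha>) p' q' (\<lambda>z. ennreal (norm (f z)) * indicator (cube L1 \<times> cube L2) z)
   \<le> morrey_herz_norm (- \<alpha>) lam p' q' f"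
  unfolding morrey_herz_norm_eq[OF exponents(4)]
  by (rule SUP_upper2[OF UNIV_I], rule SUP_upper2[OF UNIV_I], rule order_refl)

lemma herz_blockI:
  assumes "b \<in> borel_measurable lebesgue" "AE z in lebesgue. z \<notin> cube l1 \<times> cube l2 \<longrightarrow> b z = 0"
    and "eherz \<alpha> p q (\<lambda>z. ennreal (norm (b z)))
        \<le> ennreal (2 powr (- (lam * real_of_int (l1 + l2))))"
  shows "b \<in> herz_block \<alpha> lam p q"
  using assms exponents unfolding herz_block_def by (auto simp: herz_norm_eq simp del: of_int_add)

text \<open>Restricting f to the supporting rectangle of b costs nothing. After Hoelder, the size of
  b contributes exactly the factor that stands before the Herz norm of f on this rectangle in the
  Morrey-Herz supremum.\<close>

lemma block_pairing:
  fixes f b :: "(real^'n) \<times> (real^'m) \<Rightarrow> 'k::{real_normed_field, euclidean_space}"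
  assumes [measurable]: "f \<in> borel_measurable lebesgue" and b: "b \<in> herz_block \<alpha> lam p q"
  shows "(\<integral>\<^sup>+ z. ennreal (norm (f z * b z)) \<partial>lebesgue) \<le> morrey_herz_norm (- \<alpha>) lam p' q' f"
proof -
  from b obtain l1 l2 where [measurable]: "b \<in> borel_measurable lebesgue"
    and supp: "AE z in lebesgue. z \<notin> cube l1 \<times> cube l2 \<longrightarrow> b z = 0"
    and norm: "herz_norm \<alpha> p q b \<le> ennreal (2 powr (- (lam * real_of_int (l1 + l2))))"
    by (auto simp: herz_block_def)
  have [measurable]: "cube l1 \<times> cube l2 \<in> sets lebesgue" by (intro sets_lebesgue_Times sets_cube)
  have "(\<integral>\<^sup>+ z. ennreal (norm (f z * b z)) \<partial>lebesgue) =
     (\<integral>\<^sup>+ z. ennreal (norm (b z)) * (ennreal (norm (f z)) * indicator (cube l1 \<times> cube l2) z)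
         \<partial>lebesgue)"
    using supp by (intro nn_integral_cong_AE)
      (auto elim!: eventually_mono simp: norm_mult ennreal_mult mult.commute indicator_def)
  also have "\<dots> \<le> eherz \<alpha> p q (\<lambda>z. ennreal (norm (b z))) *
       eherz (- \<alpha>) p' q' (\<lambda>z. ennreal (norm (f z)) * indicator (cube l1 \<times> cube l2) z)"
    by (intro eherz_Holder p q) auto
  also have "\<dots> \<le> ennreal (2 powr (- (real_of_int (l1 + l2) * lam))) *
       eherz (- \<alpha>) p' q' (\<lambda>z. ennreal (norm (f z)) * indicator (cube l1 \<times> cube l2) z)"
    using norm exponents by (intro mult_right_mono) (simp_all add: herz_norm_eq mult.commute)
  also have "\<dots> \<le> morrey_herz_norm (- \<alpha>) lam p' q' f"
    by (rule eherz_cube_le_morrey)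
  finally show ?thesis .
qed

text \<open>Almost everywhere convergence bounds the modulus of f g by the sum of the moduli of its
  terms; Tonelli then reduces to single blocks, whose bound is uniform.\<close>

lemma block_rep_pairing:
  fixes f g :: "(real^'n) \<times> (real^'m) \<Rightarrow> 'k::{real_normed_field, euclidean_space}"
  assumes [measurable]: "f \<in> borel_measurable lebesgue" and rep: "block_rep \<alpha> lam p q g c b"
  shows "(\<integral>\<^sup>+ z. ennreal (norm (f z * g z)) \<partial>lebesgue)
      \<le> morrey_herz_norm (- \<alpha>) lam p' q' f * ennreal (\<Sum>k. norm (c k))"
proof -
  from rep have c: "summable (\<lambda>k. norm (c k))" and b: "\<And>k. b k \<in> herz_block \<alpha> lam p q"
    and sums: "AE z in lebesgue. (\<lambda>k. c k * b k z) sums g z"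
    by (auto simp: block_rep_def)
  have [measurable]: "b k \<in> borel_measurable lebesgue" for k
    using b[of k] by (simp add: herz_block_def)
  have "(\<integral>\<^sup>+ z. ennreal (norm (f z * g z)) \<partial>lebesgue)
      \<le> (\<integral>\<^sup>+ z. (\<Sum>k. ennreal (norm (c k)) * ennreal (norm (f z * b k z))) \<partial>lebesgue)"
  proof (rule nn_integral_mono_AE, use sums in eventually_elim)
    case (elim z)
    then have "(\<lambda>k. f z * (c k * b k z)) sums (f z * g z)" by (rule sums_mult)
    from norm_sums_le_suminf[OF this] show ?case
      by (simp add: norm_mult ennreal_mult mult_ac)
  qed
  also have "\<dots> = (\<Sum>k. ennreal (norm (c k)) * (\<integral>\<^sup>+ z. ennreal (norm (f z * b k z)) \<partial>lebesgue))"
    by (simp add: nn_integral_suminf nn_integral_cmult)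
  also have "\<dots> \<le> (\<Sum>k. morrey_herz_norm (- \<alpha>) lam p' q' f * ennreal (norm (c k)))"
    unfolding mult.commute[of "morrey_herz_norm (- \<alpha>) lam p' q' f"]
    by (intro suminf_le mult_left_mono block_pairing b) auto
  also have "\<dots> = morrey_herz_norm (- \<alpha>) lam p' q' f * ennreal (\<Sum>k. norm (c k))"
    using c by (simp add: suminf_ennreal2)
  finally show ?thesis .
qed

lemma pairing_le:
  fixes f g :: "(real^'n) \<times> (real^'m) \<Rightarrow> 'k::{real_normed_field, euclidean_space}"
  assumes f: "f \<in> borel_measurable lebesgue" "morrey_herz_norm (- \<alpha>) lam p' q' f < top"
    and g: "g \<in> block_herz \<alpha> lam p q"
  shows "(\<integral>\<^sup>+ z. ennreal (norm (f z * g z)) \<partial>lebesgue)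
      \<le> morrey_herz_norm (- \<alpha>) lam p' q' f * block_herz_norm \<alpha> lam p q g"
  unfolding block_herz_norm_def
  by (rule le_Inf_mult_ennreal) (use f g block_rep_pairing in \<open>auto simp: block_herz_def\<close>)

text \<open>The integrability hypothesis matters for densities \<open>f\<close> of functionals: nothing is known about
  \<open>f b\<close> for general blocks \<open>b\<close> before the norm of \<open>f\<close> is bounded.\<close>

lemma morrey_le_of_block_pairing:
  fixes f :: "(real^'n) \<times> (real^'m) \<Rightarrow> 'k::{real_normed_field, euclidean_space}"
  assumes [measurable]: "f \<in> borel_measurable lebesgue"
    and le: "\<And>b. b \<in> herz_block \<alpha> lam p q \<Longrightarrow> (\<integral>\<^sup>+ z. ennreal (norm (f z * b z)) \<partial>lebesgue) < top \<Longrightarrow>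
        (\<integral>\<^sup>+ z. ennreal (norm (f z * b z)) \<partial>lebesgue) \<le> K"
  shows "morrey_herz_norm (- \<alpha>) lam p' q' f \<le> K"
  unfolding morrey_herz_norm_eq[OF exponents(4)]
proof (intro SUP_least)
  fix L1 L2 :: int
  define R where "R = (cube L1 \<times> cube L2 :: ((real^'n) \<times> (real^'m)) set)"
  have [measurable]: "R \<in> sets lebesgue" unfolding R_def by (intro sets_lebesgue_Times sets_cube)
  define \<kappa> where "\<kappa> = 2 powr (- (real_of_int (L1 + L2) * lam))"
  have \<kappa>: "0 < \<kappa>" by (simp add: \<kappa>_def)
  \<comment> \<open>Bounded height on a set inside \<open>core n\<close> makes the Herz norm of the
    truncation finite, so that an extremal exists. The sets increase to almost all of R.\<close>
  define T where "T n = {z \<in> core n. norm (f z) \<le> real n} \<inter> R" for n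
  have [measurable]: "T n \<in> sets lebesgue" for n unfolding T_def by measurable
  define u where "u n z = ennreal (norm (f z)) * indicator (T n) z" for n z
  have [measurable]: "u n \<in> borel_measurable lebesgue" for n unfolding u_def by measurable
  have T_mono: "T m \<subseteq> T n" if "m \<le> n" for m n
    using core_mono[OF that] that by (force simp: T_def)
  have "eherz (- \<alpha>) p' q' (\<lambda>z. ennreal (norm (f z)) * indicator R z)
      \<le> eherz (- \<alpha>) p' q' (\<lambda>z. SUP n. u n z)"
  proof (rule eherz_mono_AE[OF exponents(3,4)], use AE_core in \<open>eventually_elim\<close>)
    case (elim z)
    then obtain n where n: "z \<in> core n" by blast
    define N where "N = max n (nat \<lceil>norm (f z)\<rceil>)"
    have "z \<in> core N" using n core_mono[of n N] by (auto simp: N_def)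
    moreover have "norm (f z) \<le> real N" unfolding N_def by linarith
    ultimately have "ennreal (norm (f z)) * indicator R z \<le> u N z"
      by (auto simp: u_def T_def indicator_def)
    then show ?case by (rule SUP_upper2[OF UNIV_I])
  qed
  also have "\<dots> = (SUP n. eherz (- \<alpha>) p' q' (u n))"
    using exponents T_mono[THEN subsetD, OF le_SucI[OF order_refl]]
    by (intro eherz_SUP) (auto simp: u_def intro!: mult_left_mono indicator_leI)
  finally have "ennreal \<kappa> * eherz (- \<alpha>) p' q' (\<lambda>z. ennreal (norm (f z)) * indicator R z)
      \<le> (SUP n. ennreal \<kappa> * eherz (- \<alpha>) p' q' (u n))"
    unfolding SUP_mult_left_ennreal[symmetric] by (rule mult_left_mono) simp
  also have "\<dots> \<le> K"
  proof (rule SUP_least)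
    fix n
    obtain c where c: "0 \<le> c" "\<And>M A (u :: (real^'n) \<times> (real^'m) \<Rightarrow> ennreal). A \<in> sets lebesgue \<Longrightarrow>
        A \<subseteq> core n \<Longrightarrow> (\<And>z. u z \<le> M * indicator A z) \<Longrightarrow>
       eherz (- \<alpha>) p' q' u \<le> ennreal c * (M * epowr (emeasure lebesgue A) (1 / p'))"
      using eherz_core_bound[OF exponents(3,4)] by metis
    have "eherz (- \<alpha>) p' q' (u n)
        \<le> ennreal c * (ennreal (real n) * epowr (emeasure lebesgue (core n :: ((real^'n) \<times>
            (real^'m)) set)) (1 / p'))"
      by (intro c(2)) (auto simp: u_def T_def indicator_def intro!: ennreal_leI simp del:
          ennreal_of_nat_eq_real_of_nat)
    also have "\<dots> < top"
    proof -
      have "emeasure lebesgue (core n :: ((real^'n) \<times> (real^'m)) set) < top"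
        by (rule emeasure_core_finite)
      then show ?thesis by (simp add: ennreal_mult_less_top)
    qed
    finally have fin: "eherz (- \<alpha>) p' q' (u n) < top" .
    obtain v where [measurable]: "v \<in> borel_measurable lebesgue" and v: "eherz \<alpha> p q v \<le> 1"
      "(\<integral>\<^sup>+ z. u n z * v z \<partial>lebesgue) = eherz (- \<alpha>) p' q' (u n)"
      using eherz_attained[OF p q _ fin] by auto
    \<comment> \<open>The extremal is cut to \<open>T n\<close>, which places its support in R, and
      scaled to the size of a block. Infinite values of v are replaced by 0.\<close>
    define b where "b z = (of_real (\<kappa> * enn2real (v z * indicator (T n) z)) :: 'k)" for z
    have [measurable]: "b \<in> borel_measurable lebesgue" unfolding b_def by measurable
    have norm_b: "ennreal (norm (b z))
        = ennreal \<kappa> * ennreal (enn2real (v z * indicator (T n) z))" for z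
      using \<kappa> by (simp add: b_def norm_mult ennreal_mult abs_mult)
    have "eherz \<alpha> p q (\<lambda>z. ennreal (norm (b z))) \<le> eherz \<alpha> p q (\<lambda>z. ennreal \<kappa> * v z)"
    proof (rule eherz_mono[OF exponents(1,2)])
      fix z
      have "ennreal (enn2real (v z * indicator (T n) z)) \<le> v z"
        by (cases "v z") (auto simp: indicator_def)
      then show "ennreal (norm (b z)) \<le> ennreal \<kappa> * v z"
        unfolding norm_b by (rule mult_left_mono) simp
    qed
    also have "\<dots> = ennreal \<kappa> * eherz \<alpha> p q v" using exponents by (intro eherz_cmult) auto
    also have "\<dots> \<le> ennreal \<kappa> * 1" using v by (intro mult_left_mono) auto
    finally have "b \<in> herz_block \<alpha> lam p q"
      by (intro herz_blockI[where ?l1.0 = L1 and ?l2.0 = L2])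
        (auto simp: \<kappa>_def b_def T_def R_def indicator_def mult.commute)
    moreover have "(\<integral>\<^sup>+ z. ennreal (norm (f z * b z)) \<partial>lebesgue)
        = (\<integral>\<^sup>+ z. ennreal \<kappa> * (u n z * v z) \<partial>lebesgue)"
    proof (rule nn_integral_cong_AE)
      have "AE z in lebesgue. u n z * v z \<noteq> \<infinity>"
        using v(2) fin by (intro nn_integral_PInf_AE) auto
      then show "AE z in lebesgue. ennreal (norm (f z * b z)) = ennreal \<kappa> * (u n z * v z)"
      proof eventually_elim
        case (elim z)
        have "ennreal (norm (f z * b z))
            = ennreal \<kappa> * (ennreal (norm (f z)) * ennreal (enn2real (v z * indicator (T n) z)))"
          by (simp add: norm_mult ennreal_mult norm_b mult_ac)
        also have "ennreal (norm (f z)) * ennreal (enn2real (v z * indicator (T n) z))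
            = u n z * v z"
          \<comment> \<open>Where v is infinite, finiteness of the product forces u to vanish, so
            setting v to 0 there does not change the pairing.\<close>
          using elim by (cases "v z") (auto simp: u_def indicator_def ennreal_mult_eq_top_iff
              split: if_splits)
        finally show ?case .
      qed
    qed
    moreover have "(\<integral>\<^sup>+ z. ennreal \<kappa> * (u n z * v z) \<partial>lebesgue)
        = ennreal \<kappa> * eherz (- \<alpha>) p' q' (u n)"
      by (simp add: nn_integral_cmult v(2))
    \<comment> \<open>The pairing with b equals kappa times a finite Herz norm, so b is admissible
      in \<open>le\<close>.\<close>
    ultimately show "ennreal \<kappa> * eherz (- \<alpha>) p' q' (u n) \<le> K"
      using le[of b] fin by (simp add: ennreal_mult_less_top)
  qed
  finally show "ennreal (2 powr - (real_of_int (L1 + L2) * lam)) *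
     eherz (- \<alpha>) p' q' (\<lambda>z. ennreal (norm (f z)) * indicator (cube L1 \<times> cube L2) z) \<le> K"
    by (simp add: \<kappa>_def R_def)
qed

text \<open>A representation with one nonzero term: D times the block g / D. Positivity of D allows
  the division even when the Herz norm of g is 0.\<close>

lemma block_herz_cubeI:
  fixes g :: "(real^'n) \<times> (real^'m) \<Rightarrow> 'k::{real_normed_field, euclidean_space}"
  assumes [measurable]: "g \<in> borel_measurable lebesgue"
    and supp: "AE z in lebesgue. z \<notin> cube l1 \<times> cube l2 \<longrightarrow> g z = 0"
    and D: "0 < D" and norm: "herz_norm \<alpha> p q g
        \<le> ennreal (D * 2 powr (- (lam * real_of_int (l1 + l2))))"
  shows "g \<in> block_herz \<alpha> lam p q" "block_herz_norm \<alpha> lam p q g \<le> ennreal D"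
proof -
  define c where "c k = (if k = 0 then of_real D else 0 :: 'k)" for k :: nat
  define b where "b k z = (if k = 0 then of_real (1 / D) * g z else 0)" for k :: nat and z
  have "eherz \<alpha> p q (\<lambda>z :: (real^'n) \<times> (real^'m). 0) = 0"
    using eherz_cmult[OF exponents(1,2), of "\<lambda>z. 0" \<alpha> 0] by simp
  moreover have "eherz \<alpha> p q (\<lambda>z. ennreal (norm (b 0 z)))
      = ennreal (1 / D) * eherz \<alpha> p q (\<lambda>z. ennreal (norm (g z)))"
    using D exponents by (simp add: b_def norm_mult ennreal_mult eherz_cmult norm_divide
        norm_inverse divide_inverse abs_mult)
  moreover have "\<dots> \<le> ennreal (1 / D) * ennreal (D * 2 powr (- (lam * real_of_int (l1 + l2))))"
    using norm exponents by (intro mult_left_mono) (simp_all add: herz_norm_eq)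
  moreover have "\<dots> = ennreal (2 powr (- (lam * real_of_int (l1 + l2))))"
    using D by (simp add: ennreal_mult[symmetric])
  moreover have "b k \<in> borel_measurable lebesgue" for k unfolding b_def by measurable
  ultimately have b: "b k \<in> herz_block \<alpha> lam p q" for k
    using supp
    by (intro herz_blockI[where ?l1.0 = l1 and ?l2.0 = l2]; cases "k = 0")
      (auto simp: b_def elim!: eventually_mono)
  have "(\<lambda>k. c k * b k z) sums g z" for z
    using sums_finite[of "{0}" "\<lambda>k. c k * b k z"] D by (simp add: c_def b_def)
  moreover have c: "(\<lambda>k. norm (c k)) sums D"
    using sums_finite[of "{0}" "\<lambda>k. norm (c k)"] D by (simp add: c_def)
  ultimately have "block_rep \<alpha> lam p q g c b" using b by (auto simp: block_rep_def sums_iff)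
  then show "g \<in> block_herz \<alpha> lam p q" "block_herz_norm \<alpha> lam p q g \<le> ennreal D"
    using c by (auto simp: block_herz_def block_herz_norm_def sums_iff intro!: Inf_lower exI[of _
        c] exI[of _ b])
qed

lemma herz_block_in_block_herz:
  fixes b :: "(real^'n) \<times> (real^'m) \<Rightarrow> 'k::{real_normed_field, euclidean_space}"
  assumes "b \<in> herz_block \<alpha> lam p q"
  shows "b \<in> block_herz \<alpha> lam p q" "block_herz_norm \<alpha> lam p q b \<le> 1"
  using assms block_herz_cubeI[of b _ _ 1] by (auto simp: herz_block_def)

text \<open>On functions supported in a fixed rectangle, Herz convergence implies convergence in the
  block space. This lets a bounded functional be computed by approximation in the Herz norm.\<close>

lemma block_herz_norm_le_herz:
  fixes g :: "(real^'n) \<times> (real^'m) \<Rightarrow> 'k::{real_normed_field, euclidean_space}"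
  assumes g: "g \<in> borel_measurable lebesgue"
    and supp: "AE z in lebesgue. z \<notin> cube l1 \<times> cube l2 \<longrightarrow> g z = 0"
    and fin: "herz_norm \<alpha> p q g < top"
  shows "g \<in> block_herz \<alpha> lam p q"
    "block_herz_norm \<alpha> lam p q g
        \<le> ennreal (2 powr (lam * real_of_int (l1 + l2))) * herz_norm \<alpha> p q g"
proof -
  define h where "h = enn2real (herz_norm \<alpha> p q g)"
  have h: "herz_norm \<alpha> p q g = ennreal h" "0 \<le> h" using fin by (auto simp: h_def)
  define \<kappa> where "\<kappa> = 2 powr (lam * real_of_int (l1 + l2))"
  have \<kappa>: "0 < \<kappa>" "2 powr (- (lam * real_of_int (l1 + l2))) = 1 / \<kappa>"
      by (simp_all add: \<kappa>_def powr_minus_divide)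
  \<comment> \<open>The slack e keeps the coefficient positive when the Herz norm vanishes; it is
    removed afterwards.\<close>
  have *: "g \<in> block_herz \<alpha> lam p q" "block_herz_norm \<alpha> lam p q g
      \<le> ennreal (\<kappa> * h + e)" if "0 < e" for e
  proof -
    have "0 < \<kappa> * h + e" using \<kappa>(1) h(2) that by (intro add_nonneg_pos) auto
    moreover have "herz_norm \<alpha> p q g
        \<le> ennreal ((\<kappa> * h + e) * 2 powr (- (lam * real_of_int (l1 + l2))))"
      unfolding h(1) \<kappa>(2) using \<kappa>(1) that by (intro ennreal_leI) (simp add: field_simps)
    ultimately show "g \<in> block_herz \<alpha> lam p q" "block_herz_norm \<alpha> lam p q g \<le> ennreal (\<kappa> * h + e)"
      using block_herz_cubeI[OF g supp] by blast+
  qed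
  show "g \<in> block_herz \<alpha> lam p q" using *(1)[of 1] by simp
  have "block_herz_norm \<alpha> lam p q g \<le> ennreal \<kappa> * herz_norm \<alpha> p q g"
  proof (rule ennreal_le_epsilon)
    fix e :: real assume "0 < e"
    then show "block_herz_norm \<alpha> lam p q g \<le> ennreal \<kappa> * herz_norm \<alpha> p q g + ennreal e"
      using *(2)[of e] \<kappa> h by (simp add: ennreal_mult)
  qed
  then show "block_herz_norm \<alpha> lam p q g
      \<le> ennreal (2 powr (lam * real_of_int (l1 + l2))) * herz_norm \<alpha> p q g"
    by (simp add: \<kappa>_def)
qed

text \<open>Blocks belong to the unit ball of the block space, so testing on them is part of the
  supremum; it already exhausts the Morrey-Herz norm.\<close>

lemma pairing_norm_eq_morrey:
  fixes f :: "(real^'n) \<times> (real^'m) \<Rightarrow> 'k::{real_normed_field, euclidean_space}"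
  assumes f: "f \<in> borel_measurable lebesgue" "morrey_herz_norm (- \<alpha>) lam p' q' f < top"
  shows "pairing_norm \<alpha> lam p q f = morrey_herz_norm (- \<alpha>) lam p' q' f"
proof (rule antisym)
  show "pairing_norm \<alpha> lam p q f \<le> morrey_herz_norm (- \<alpha>) lam p' q' f"
    unfolding pairing_norm_def
  proof (rule SUP_least)
    fix g :: "(real^'n) \<times> (real^'m) \<Rightarrow> 'k" assume g: "g \<in> {g \<in> block_herz \<alpha> lam p q.
        block_herz_norm \<alpha> lam p q g \<le> 1}"
    have "Lnorm 1 (\<lambda>z. f z * g z)
        \<le> morrey_herz_norm (- \<alpha>) lam p' q' f * block_herz_norm \<alpha> lam p q g"
      using g unfolding Lnorm_1 by (intro pairing_le f) simp
    also have "\<dots> \<le> morrey_herz_norm (- \<alpha>) lam p' q' f * 1"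
      using g by (intro mult_left_mono) auto
    finally show "Lnorm 1 (\<lambda>z. f z * g z) \<le> morrey_herz_norm (- \<alpha>) lam p' q' f" by simp
  qed
  show "morrey_herz_norm (- \<alpha>) lam p' q' f \<le> pairing_norm \<alpha> lam p q f"
  proof (rule morrey_le_of_block_pairing[OF f(1)])
    fix b :: "(real^'n) \<times> (real^'m) \<Rightarrow> 'k" assume "b \<in> herz_block \<alpha> lam p q"
    then show "(\<integral>\<^sup>+ z. ennreal (norm (f z * b z)) \<partial>lebesgue) \<le> pairing_norm \<alpha> lam p q f"
      unfolding pairing_norm_def Lnorm_1 using herz_block_in_block_herz
      by (intro SUP_upper2[of b]) auto
  qed
qed

lemma functional_in_dual:
  fixes f :: "(real^'n) \<times> (real^'m) \<Rightarrow> 'k::{real_normed_field, euclidean_space}"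
  assumes f[measurable]: "f \<in> borel_measurable lebesgue" and fin: "morrey_herz_norm (- \<alpha>) lam p'
      q' f < top"
  shows "\<And>g. g \<in> block_herz \<alpha> lam p q \<Longrightarrow> integrable lebesgue (\<lambda>z. f z * g z)"
    "(\<lambda>g. \<integral>z. f z * g z \<partial>lebesgue) \<in> block_herz_dual \<alpha> lam p q"
proof -
  show int: "integrable lebesgue (\<lambda>z. f z * g z)" if g: "g \<in> block_herz \<alpha> lam p q" for g
  proof (rule integrableI_bounded)
    obtain c b where "block_rep \<alpha> lam p q g c b" and [measurable]: "g \<in> borel_measurable lebesgue"
      using g by (auto simp: block_herz_def)
    show "(\<lambda>z. f z * g z) \<in> borel_measurable lebesgue" by measurable
    have "(\<integral>\<^sup>+ z. ennreal (norm (f z * g z)) \<partial>lebesgue)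
        \<le> morrey_herz_norm (- \<alpha>) lam p' q' f * ennreal (\<Sum>k. norm (c k))"
      by (rule block_rep_pairing) fact+
    also have "\<dots> < top" using fin by (simp add: ennreal_mult_less_top)
    finally show "(\<integral>\<^sup>+ z. ennreal (norm (f z * g z)) \<partial>lebesgue) < \<infinity>" by simp
  qed
  define C where "C = enn2real (morrey_herz_norm (- \<alpha>) lam p' q' f)"
  have C: "ennreal C = morrey_herz_norm (- \<alpha>) lam p' q' f" "0 \<le> C"
    using fin by (auto simp: C_def)
  have "ennreal (norm (\<integral>z. f z * g z \<partial>lebesgue)) \<le> ennreal C * block_herz_norm \<alpha> lam p q g"
    if g: "g \<in> block_herz \<alpha> lam p q" for g
  proof -
    have "ennreal (norm (\<integral>z. f z * g z \<partial>lebesgue)) \<le> (\<integral>\<^sup>+ z. ennreal (norm (f z * g z)) \<partial>lebesgue)"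
      by (rule integral_norm_bound_ennreal) (rule int[OF g])
    also have "\<dots> \<le> ennreal C * block_herz_norm \<alpha> lam p q g"
      unfolding C(1) by (rule pairing_le[OF f fin g])
    finally show ?thesis .
  qed
  moreover have "(\<integral>z. f z * (g z + h z) \<partial>lebesgue)
      = (\<integral>z. f z * g z \<partial>lebesgue) + (\<integral>z. f z * h z \<partial>lebesgue)"
    if "g \<in> block_herz \<alpha> lam p q" "h \<in> block_herz \<alpha> lam p q" for g h
    using int[OF that(1)] int[OF that(2)] by (simp add: distrib_left)
  moreover have "(\<integral>z. f z * (c * g z) \<partial>lebesgue) = c * (\<integral>z. f z * g z \<partial>lebesgue)"
    if "g \<in> block_herz \<alpha> lam p q" for g c
    by (simp add: mult.left_commute[of _ c])
  ultimately show "(\<lambda>g. \<integral>z. f z * g z \<partial>lebesgue) \<in> block_herz_dual \<alpha> lam p q"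
    unfolding block_herz_dual_def using C(2) by blast
qed

end

section \<open>Representation of bounded functionals\<close>

text \<open>Test functions for the representation. Vanishing outside \<open>core n\<close> is
  required at every point, so that the pointwise identities for finite sums apply directly to a
  functional.\<close>

definition core_bounded :: "nat \<Rightarrow> ((real^'n) \<times> (real^'m) \<Rightarrow> 'k::real_normed_vector) set" where
  "core_bounded n = {g \<in> borel_measurable lebesgue. (\<exists>M. \<forall>z. norm (g z)
      \<le> M) \<and> (\<forall>z. z \<notin> core n \<longrightarrow> g z = 0)}"

lemma core_bounded_measurable [measurable_dest]: "g \<in> core_bounded n \<Longrightarrow>
    g \<in> borel_measurable lebesgue"
  by (simp add: core_bounded_def)

lemma core_bounded_sum:
  fixes g :: "'i \<Rightarrow> (real^'n) \<times> (real^'m) \<Rightarrow> 'k::euclidean_space"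
  assumes "\<And>i. i \<in> I \<Longrightarrow> g i \<in> core_bounded n"
  shows "(\<lambda>z. \<Sum>i\<in>I. g i z) \<in> core_bounded n"
proof -
  have "\<forall>i\<in>I. \<exists>M. \<forall>z. norm (g i z) \<le> M" using assms by (auto simp: core_bounded_def)
  from bchoice[OF this] obtain M where "\<And>i z. i \<in> I \<Longrightarrow> norm (g i z) \<le> M i" by blast
  then have "norm (\<Sum>i\<in>I. g i z) \<le> (\<Sum>i\<in>I. M i)" for z by (intro sum_norm_le)
  moreover have "(\<lambda>z. \<Sum>i\<in>I. g i z) \<in> borel_measurable lebesgue"
    using assms by (intro borel_measurable_sum core_bounded_measurable)
  ultimately show ?thesis
    using assms unfolding core_bounded_def
        by (intro CollectI conjI exI allI impI sum.neutral ballI) auto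
qed

lemma core_bounded_mult:
  fixes g :: "(real^'n) \<times> (real^'m) \<Rightarrow> 'k::{real_normed_field, euclidean_space}"
  assumes "g \<in> core_bounded n"
  shows "(\<lambda>z. c * g z) \<in> core_bounded n"
proof -
  from assms obtain M where "\<And>z. norm (g z) \<le> M" by (auto simp: core_bounded_def)
  then have "norm (c * g z) \<le> norm c * M" for z by (simp add: norm_mult mult_left_mono)
  then show ?thesis using assms by (auto simp: core_bounded_def)
qed

lemma indicator_core_bounded:
  assumes "A \<in> sets lebesgue" "A \<subseteq> core n"
  shows "(indicator A :: _ \<Rightarrow> 'k::{real_normed_field, euclidean_space}) \<in> core_bounded n"
  using assms by (auto simp: core_bounded_def indicator_def intro!: exI[of _ 1])

lemma core_disjointed:
  "core n = (\<Union>k\<le>n. disjointed core k)"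
  using finite_UN_disjointed_eq[of core "Suc n"] core_mono[of _ n]
  by (auto simp: atLeast0LessThan lessThan_Suc_atMost)

context herz_duality
begin

lemma block_herz_cmult:
  fixes b :: "(real^'n) \<times> (real^'m) \<Rightarrow> 'k::{real_normed_field, euclidean_space}"
  assumes "b \<in> herz_block \<alpha> lam p q"
  shows "(\<lambda>z. c * b z) \<in> block_herz \<alpha> lam p q"
proof -
  define d where "d k = (if k = 0 then c else 0)" for k :: nat
  have "(\<lambda>k. d k * b z) sums (c * b z)" for z
    using sums_finite[of "{0}" "\<lambda>k. d k * b z"] by (simp add: d_def)
  moreover have "summable (\<lambda>k. norm (d k))"
    using summable_finite[of "{0}" "\<lambda>k. norm (d k)"] by (simp add: d_def)
  ultimately have "block_rep \<alpha> lam p q (\<lambda>z. c * b z) d (\<lambda>k. b)"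
    using assms by (simp add: block_rep_def)
  moreover have "b \<in> borel_measurable lebesgue" using assms by (simp add: herz_block_def)
  ultimately show ?thesis by (auto simp: block_herz_def)
qed

text \<open>The remainder after N terms is represented by the shifted series, so its block norm is
  at most the tail of the coefficient sum. Boundedness sends its image to 0.\<close>

lemma dual_sums:
  fixes g :: "(real^'n) \<times> (real^'m) \<Rightarrow> 'k::{real_normed_field, euclidean_space}"
  assumes \<Phi>: "\<Phi> \<in> block_herz_dual \<alpha> lam p q"
    and [measurable]: "g \<in> borel_measurable lebesgue" and rep: "block_rep \<alpha> lam p q g c b"
  shows "(\<lambda>k. c k * \<Phi> (b k)) sums \<Phi> g"
proof -
  from rep have c: "summable (\<lambda>k. norm (c k))" and b: "\<And>k. b k \<in> herz_block \<alpha> lam p q"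
    and sums: "AE z in lebesgue. (\<lambda>k. c k * b k z) sums g z"
    by (auto simp: block_rep_def)
  have [measurable]: "b k \<in> borel_measurable lebesgue" for k
    using b[of k] by (simp add: herz_block_def)
  \<comment> \<open>The remainder is g minus a partial sum at every point, also where the series
    diverges. Splitting off a term is then an equality of functions, as additivity of the functional
    demands.\<close>
  define t where "t N z = g z - (\<Sum>k<N. c k * b k z)" for N z
  have rep_t: "block_rep \<alpha> lam p q (t N) (\<lambda>k. c (k + N)) (\<lambda>k. b (k + N))" for N
    unfolding block_rep_def
  proof (intro conjI allI b)
    show "summable (\<lambda>k. norm (c (k + N)))" by (rule summable_ignore_initial_segment[OF c])
    show "AE z in lebesgue. (\<lambda>k. c (k + N) * b (k + N) z) sums t N z"
      using sums by eventually_elim (unfold t_def, rule sums_split_initial_segment)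
  qed
  have [measurable]: "t N \<in> borel_measurable lebesgue" for N unfolding t_def by measurable
  have t: "t N \<in> block_herz \<alpha> lam p q" for N
    using rep_t by (auto simp: block_herz_def)
  from \<Phi> obtain C where add: "\<And>g h. g \<in> block_herz \<alpha> lam p q \<Longrightarrow> h \<in> block_herz \<alpha> lam p q \<Longrightarrow>
      \<Phi> (\<lambda>z. g z + h z) = \<Phi> g + \<Phi> h"
    and scale: "\<And>c g. g \<in> block_herz \<alpha> lam p q \<Longrightarrow> \<Phi> (\<lambda>z. c * g z) = c * \<Phi> g"
    and C: "0 \<le> C" "\<And>g. g \<in> block_herz \<alpha> lam p q \<Longrightarrow>
        ennreal (norm (\<Phi> g)) \<le> ennreal C * block_herz_norm \<alpha> lam p q g"
    unfolding block_herz_dual_def by blast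
  have step: "\<Phi> (t N) = c N * \<Phi> (b N) + \<Phi> (t (Suc N))" for N
  proof -
    have "t N = (\<lambda>z. c N * b N z + t (Suc N) z)" by (auto simp: t_def)
    then have "\<Phi> (t N) = \<Phi> (\<lambda>z. c N * b N z + t (Suc N) z)" by simp
    also have "\<dots> = c N * \<Phi> (b N) + \<Phi> (t (Suc N))"
      by (simp add: add block_herz_cmult b t scale herz_block_in_block_herz)
    finally show ?thesis .
  qed
  have "\<Phi> g = (\<Sum>k<N. c k * \<Phi> (b k)) + \<Phi> (t N)" for N
  proof (induction N)
    case 0
    have "t 0 = g" by (auto simp: t_def)
    then show ?case by simp
  next
    case (Suc N)
    then show ?case using step[of N] by simp
  qed
  then have eq: "(\<Sum>k<N. c k * \<Phi> (b k)) = \<Phi> g - \<Phi> (t N)" for N by (simp add: algebra_simps)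
  have "norm (\<Phi> (t N)) \<le> C * (\<Sum>k. norm (c (k + N)))" for N
  proof -
    have "block_herz_norm \<alpha> lam p q (t N) \<le> ennreal (\<Sum>k. norm (c (k + N)))"
      unfolding block_herz_norm_def using rep_t[of N] by (auto intro!: Inf_lower)
    with C(2)[OF t, of N] have "ennreal (norm (\<Phi> (t N)))
        \<le> ennreal C * ennreal (\<Sum>k. norm (c (k + N)))"
      by (meson mult_left_mono order_trans zero_le)
    moreover have "0 \<le> (\<Sum>k. norm (c (k + N)))"
      by (rule suminf_nonneg[OF summable_ignore_initial_segment[OF c]]) simp
    ultimately show ?thesis
      using C(1) by (simp add: ennreal_mult[symmetric])
  qed
  moreover have "(\<lambda>N. C * (\<Sum>k. norm (c (k + N)))) \<longlonglongrightarrow> 0"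
  proof -
    have "(\<lambda>N. C * (\<Sum>k. norm (c (k + N)))) \<longlonglongrightarrow> C * 0"
    proof (intro tendsto_mult tendsto_const)
      have "(\<lambda>N. (\<Sum>k. norm (c k)) - (\<Sum>k<N. norm (c k))) \<longlonglongrightarrow> (\<Sum>k. norm (c k)) - (\<Sum>k. norm (c k))"
        by (intro tendsto_diff tendsto_const summable_LIMSEQ c)
      then show "(\<lambda>N. (\<Sum>k. norm (c (k + N)))) \<longlonglongrightarrow> 0"
        by (simp add: suminf_minus_initial_segment[OF c])
    qed
    then show ?thesis by simp
  qed
  ultimately have "(\<lambda>N. \<Phi> (t N)) \<longlonglongrightarrow> 0"
    by (rule Lim_null_comparison[OF always_eventually[OF allI]])
  from tendsto_diff[OF tendsto_const[of "\<Phi> g"] this] show ?thesis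
    unfolding sums_def eq by simp
qed

lemma core_bounded_block_herz:
  fixes g :: "(real^'n) \<times> (real^'m) \<Rightarrow> 'k::{real_normed_field, euclidean_space}"
  assumes g: "g \<in> core_bounded n"
  shows "g \<in> block_herz \<alpha> lam p q" "herz_norm \<alpha> p q g < top"
proof -
  from g have [measurable]: "g \<in> borel_measurable lebesgue" by measurable
  from g obtain M where M: "\<And>z. norm (g z) \<le> M" and supp: "\<And>z. z \<notin> core n \<Longrightarrow> g z = 0"
    by (auto simp: core_bounded_def)
  obtain c where c: "0 \<le> c" "\<And>M A (u :: (real^'n) \<times> (real^'m) \<Rightarrow> ennreal). A \<in> sets lebesgue \<Longrightarrow>
      A \<subseteq> core n \<Longrightarrow> (\<And>z. u z \<le> M * indicator A z) \<Longrightarrow>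
     eherz \<alpha> p q u \<le> ennreal c * (M * epowr (emeasure lebesgue A) (1 / p))"
    using eherz_core_bound[OF exponents(1,2)] by metis
  have "eherz \<alpha> p q (\<lambda>z. ennreal (norm (g z))) \<le>
      ennreal c * (ennreal M * epowr (emeasure lebesgue (core n :: ((real^'n) \<times> (real^'m)) set))
          (1 / p))"
    using M supp by (intro c(2)) (auto simp: indicator_def intro: ennreal_leI)
  also have "\<dots> < top"
  proof -
    have "emeasure lebesgue (core n :: ((real^'n) \<times> (real^'m)) set) < top"
      by (rule emeasure_core_finite)
    then show ?thesis by (simp add: ennreal_mult_less_top)
  qed
  finally show fin: "herz_norm \<alpha> p q g < top" using exponents by (simp add: herz_norm_eq)
  have "z \<notin> cube (int n) \<times> cube (int n) \<longrightarrow> g z = 0" for z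
    using supp[of z] core_subset_cube by blast
  then show "g \<in> block_herz \<alpha> lam p q"
    by (intro block_herz_norm_le_herz(1)[OF _ _ fin, of "int n" "int n"]) auto
qed

end

section \<open>From a bounded functional with fixed bound C to its density\<close>

locale herz_functional = herz_duality +
  fixes \<Lambda> :: "((real^'n) \<times> (real^'m) \<Rightarrow> 'k::{real_normed_field, euclidean_space}) \<Rightarrow> 'k" and C :: real
  assumes C: "0 \<le> C"
    and add: "\<And>g h. g \<in> block_herz \<alpha> lam p q \<Longrightarrow> h \<in> block_herz \<alpha> lam p q \<Longrightarrow>
        \<Lambda> (\<lambda>z. g z + h z) = \<Lambda> g + \<Lambda> h"
    and scale: "\<And>c g. g \<in> block_herz \<alpha> lam p q \<Longrightarrow> \<Lambda> (\<lambda>z. c * g z) = c * \<Lambda> g"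
    and bound: "\<And>g. g \<in> block_herz \<alpha> lam p q \<Longrightarrow>
        ennreal (norm (\<Lambda> g)) \<le> ennreal C * block_herz_norm \<alpha> lam p q g"
begin

lemma bound_cube:
  assumes g: "g \<in> borel_measurable lebesgue" "AE z in lebesgue. z \<notin> cube l1 \<times> cube l2 \<longrightarrow> g z = 0"
    "herz_norm \<alpha> p q g < top"
  shows "ennreal (norm (\<Lambda> g))
      \<le> ennreal (C * 2 powr (lam * real_of_int (l1 + l2))) * herz_norm \<alpha> p q g"
proof -
  have "ennreal (norm (\<Lambda> g)) \<le> ennreal C * block_herz_norm \<alpha> lam p q g"
    by (rule bound[OF block_herz_norm_le_herz(1)[OF g]])
  also have "\<dots> \<le> ennreal C * (ennreal (2 powr (lam * real_of_int (l1 + l2))) * herz_norm \<alpha> p q g)"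
    by (intro mult_left_mono block_herz_norm_le_herz(2) g) simp
  finally show ?thesis using C by (simp add: ennreal_mult mult.assoc)
qed

lemma zero: "\<Lambda> (\<lambda>z. 0) = 0"
proof -
  have "(\<lambda>z. 0) \<in> core_bounded 0" by (auto simp: core_bounded_def)
  then have "(\<lambda>z. 0 :: 'k) \<in> block_herz \<alpha> lam p q" by (rule core_bounded_block_herz)
  from scale[OF this, of 0] show ?thesis by simp
qed

lemma sum_core_bounded:
  assumes "finite I" "\<And>i. i \<in> I \<Longrightarrow> g i \<in> core_bounded n"
  shows "\<Lambda> (\<lambda>z. \<Sum>i\<in>I. g i z) = (\<Sum>i\<in>I. \<Lambda> (g i))"
  using assms
proof (induction I rule: finite_induct)
  case empty
  then show ?case by (simp add: zero)
next
  case (insert i I)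
  have "g i \<in> block_herz \<alpha> lam p q" "(\<lambda>z. \<Sum>i\<in>I. g i z) \<in> block_herz \<alpha> lam p q"
    using insert.prems by (auto intro!: core_bounded_block_herz(1)[of _ n] core_bounded_sum)
  from add[OF this] show ?case using insert by simp
qed

text \<open>This is the hypothesis of \<open>additive_Radon_Nikodym\<close>, with the positive
  exponent 1/p. The constant collects C, the size of the enclosing cube and the weights of the
  shells in \<open>core n\<close>.\<close>

lemma indicator_bound:
  obtains c where "0 \<le> c"
    "\<And>A. A \<in> sets lebesgue \<Longrightarrow> A \<subseteq> core n \<Longrightarrow>
        norm (\<Lambda> (indicator A)) \<le> c * measure lebesgue A powr (1 / p)"
proof -
  obtain c where c: "0 \<le> c" "\<And>M A (u :: (real^'n) \<times> (real^'m) \<Rightarrow> ennreal). A \<in> sets lebesgue \<Longrightarrow>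
      A \<subseteq> core n \<Longrightarrow> (\<And>z. u z \<le> M * indicator A z) \<Longrightarrow>
     eherz \<alpha> p q u \<le> ennreal c * (M * epowr (emeasure lebesgue A) (1 / p))"
    using eherz_core_bound[OF exponents(1,2)] by metis
  define c' where "c' = C * 2 powr (lam * real_of_int (int n + int n)) * c"
  have "norm (\<Lambda> (indicator A))
      \<le> c' * measure lebesgue A powr (1 / p)" if A: "A \<in> sets lebesgue" "A \<subseteq> core n" for A
  proof -
    have cb: "(indicator A :: _ \<Rightarrow> 'k) \<in> core_bounded n" by (rule indicator_core_bounded[OF A])
    have em: "emeasure lebesgue A = ennreal (measure lebesgue A)"
      using emeasure_mono[OF A(2), of lebesgue] emeasure_core_finite[of n, where ?'a = 'n and ?'b
          = 'm]
      by (intro emeasure_eq_ennreal_measure) auto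
    have "z \<notin> cube (int n) \<times> cube (int n) \<longrightarrow> indicator A z = (0 :: 'k)" for z
      using A(2) core_subset_cube by (force simp: indicator_def)
    then have "ennreal (norm (\<Lambda> (indicator A)))
        \<le> ennreal (C * 2 powr (lam * real_of_int (int n + int n))) * herz_norm \<alpha> p q (indicator A
            :: _ \<Rightarrow> 'k)"
      using cb by (intro bound_cube core_bounded_block_herz(2)[OF cb]) (auto simp: core_bounded_def)
    also have "herz_norm \<alpha> p q (indicator A :: _ \<Rightarrow> 'k)
        \<le> ennreal c * (1 * epowr (emeasure lebesgue A) (1 / p))"
      unfolding herz_norm_eq[OF exponents(2)]
      by (intro c(2) A) (auto simp: indicator_def)
    finally have "ennreal (norm (\<Lambda> (indicator A)))
        \<le> ennreal (C * 2 powr (lam * real_of_int (int n + int n))) *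
        (ennreal c * ennreal (measure lebesgue A powr (1 / p)))"
      by (simp add: em mult_left_mono)
    then show ?thesis using C c(1) by (simp add: c'_def ennreal_mult[symmetric] mult.assoc)
  qed
  moreover have "0 \<le> c'" using C c(1) by (simp add: c'_def)
  ultimately show ?thesis using that by blast
qed

text \<open>Densities are taken on the disjoint differences of the sets \<open>core k\<close> rather
  than on these sets themselves, so that gluing raises no question of consistency on
  overlaps.\<close>

lemma representation_disjointed:
  "\<exists>f. integrable lebesgue (\<lambda>z. indicator (disjointed core k) z *\<^sub>R f z) \<and> f \<in> borel_measurable
      lebesgue \<and>
     (\<forall>A\<in>sets lebesgue. \<Lambda> (indicator (A \<inter> disjointed core k)) =
        (\<integral>z. indicator A z *\<^sub>R (indicator (disjointed core k) z *\<^sub>R f z) \<partial>lebesgue))"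
proof -
  define D where "D = (disjointed core k :: ((real^'n) \<times> (real^'m)) set)"
  have D[measurable]: "D \<in> sets lebesgue" unfolding D_def disjointed_def by measurable
  have sub: "D \<subseteq> core k" unfolding D_def by (rule disjointed_subset)
  \<comment> \<open>Lebesgue measure concentrated on D, but keeping the sigma-algebra of the whole
    space, as the set function is evaluated on intersections with D.\<close>
  define M where "M = density lebesgue (\<lambda>z. ennreal (indicator D z))"
  have emM: "emeasure M A = emeasure lebesgue (A \<inter> D)" if [measurable]: "A \<in> sets lebesgue" for A
    unfolding M_def
    by (subst emeasure_density) (auto simp: nn_integral_indicator[symmetric] indicator_def intro!:
        nn_integral_cong simp del: nn_integral_indicator)
  have "emeasure lebesgue D < top"
    using emeasure_mono[OF sub, of lebesgue] emeasure_core_finite[of k, where ?'a = 'n and ?'b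
        = 'm] by auto
  then have fin: "finite_measure M"
    by (intro finite_measureI) (auto simp: emM M_def[THEN arg_cong[where f = space]])
  obtain c where c: "0 \<le> c" "\<And>A. A \<in> sets lebesgue \<Longrightarrow> A \<subseteq> core k \<Longrightarrow>
      norm (\<Lambda> (indicator A)) \<le> c * measure lebesgue A powr (1 / p)"
    using indicator_bound[of k] by blast
  have "\<exists>f. integrable M f \<and> (\<forall>A\<in>sets M. \<Lambda> (indicator (A \<inter> D)) = (\<integral>z. indicator A z *\<^sub>R f z \<partial>M))"
  proof (rule additive_Radon_Nikodym[OF fin, where C = c and t = "1 / p"])
    fix A B assume AB: "A \<in> sets M" "B \<in> sets M" "A \<inter> B = {}"
    then have [measurable]: "A \<in> sets lebesgue" "B \<in> sets lebesgue" by (auto simp: M_def)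
    have "indicator ((A \<union> B) \<inter> D) = (\<lambda>z. indicator (A \<inter> D) z + indicator (B \<inter> D) z :: 'k)"
      by (rule ext) (use AB(3) in \<open>auto simp: indicator_def\<close>)
    moreover have "(indicator (A \<inter> D) :: _ \<Rightarrow> 'k) \<in> block_herz \<alpha> lam p q" "(indicator (B \<inter> D) :: _
        \<Rightarrow> 'k) \<in> block_herz \<alpha> lam p q"
      by (intro core_bounded_block_herz(1)[of _ k] indicator_core_bounded le_infI2 sub; measurable)+
    ultimately show "\<Lambda> (indicator ((A \<union> B) \<inter> D)) = \<Lambda> (indicator (A \<inter> D)) + \<Lambda> (indicator (B \<inter> D))"
      by (simp add: add)
  next
    fix A assume A: "A \<in> sets M"
    then have [measurable]: "A \<in> sets lebesgue" by (auto simp: M_def)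
    have "norm (\<Lambda> (indicator (A \<inter> D))) \<le> c * measure lebesgue (A \<inter> D) powr (1 / p)"
      using sub by (intro c) auto
    then show "norm (\<Lambda> (indicator (A \<inter> D))) \<le> c * measure M A powr (1 / p)"
      by (simp add: measure_def emM)
  qed (use c exponents in auto)
  then obtain f where f: "integrable M f" "\<And>A. A \<in> sets M \<Longrightarrow>
      \<Lambda> (indicator (A \<inter> D)) = (\<integral>z. indicator A z *\<^sub>R f z \<partial>M)"
    by blast
  have [measurable]: "f \<in> borel_measurable lebesgue"
    using borel_measurable_integrable[OF f(1)] by (simp add: M_def)
  have "integrable lebesgue (\<lambda>z. indicator D z *\<^sub>R f z)"
    using f(1) unfolding M_def by (subst (asm) integrable_density) auto
  moreover have "\<Lambda> (indicator (A \<inter> D))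
      = (\<integral>z. indicator A z *\<^sub>R (indicator D z *\<^sub>R f z) \<partial>lebesgue)" if [measurable]: "A \<in> sets
          lebesgue" for A
  proof -
    have "\<Lambda> (indicator (A \<inter> D)) = (\<integral>z. indicator A z *\<^sub>R f z \<partial>M)" by (rule f(2)) (simp add: M_def)
    also have "\<dots> = (\<integral>z. indicator D z *\<^sub>R (indicator A z *\<^sub>R f z) \<partial>lebesgue)"
      unfolding M_def by (rule integral_density) auto
    finally show ?thesis by (simp only: scaleR_left_commute)
  qed
  ultimately show ?thesis by (auto simp: D_def)
qed

lemma representation_indicator:
  obtains f where "f \<in> borel_measurable lebesgue"
    "\<And>n. integrable lebesgue (\<lambda>z. indicator (core n) z *\<^sub>R f z)"
    "\<And>n A. A \<in> sets lebesgue \<Longrightarrow> A \<subseteq> core n \<Longrightarrow> \<Lambda> (indicator A) = (\<integral>z. indicator A z *\<^sub>R f z \<partial>lebesgue)"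
proof -
  define D where "D k = (disjointed core k :: ((real^'n) \<times> (real^'m)) set)" for k
  have D[measurable]: "D k \<in> sets lebesgue" for k unfolding D_def disjointed_def by measurable
  have D_notin: "z \<in> D k \<Longrightarrow> j \<noteq> k \<Longrightarrow> z \<notin> D j" for z k j
    using disjoint_family_disjointed[of core] unfolding D_def disjoint_family_on_def by blast
  have core_D: "core n = (\<Union>k\<le>n. D k)" for n unfolding D_def by (rule core_disjointed)
  have "\<forall>k. \<exists>f. integrable lebesgue (\<lambda>z. indicator (D k) z *\<^sub>R f z) \<and> f \<in> borel_measurable
      lebesgue \<and>
     (\<forall>A\<in>sets lebesgue. \<Lambda> (indicator (A \<inter> D k))
         = (\<integral>z. indicator A z *\<^sub>R (indicator (D k) z *\<^sub>R f z) \<partial>lebesgue))"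
    using representation_disjointed unfolding D_def by blast
  from choice[OF this] obtain F where F: "\<And>k. integrable lebesgue (\<lambda>z. indicator (D k) z *\<^sub>R F k z)"
    "\<And>k A. A \<in> sets lebesgue \<Longrightarrow>
        \<Lambda> (indicator (A \<inter> D k)) = (\<integral>z. indicator A z *\<^sub>R (indicator (D k) z *\<^sub>R F k z) \<partial>lebesgue)"
    and [measurable]: "\<And>k. F k \<in> borel_measurable lebesgue"
    by blast
  \<comment> \<open>At most one term is nonzero at each point, and on \<open>core n\<close> only the
    first n + 1 pieces occur. All later interchanges of sum and integral are therefore
    finite.\<close>
  define f where "f z = (\<Sum>k. indicator (D k) z *\<^sub>R F k z)" for z
  have [measurable]: "f \<in> borel_measurable lebesgue" unfolding f_def by measurable
  have f_D: "f z = F k z" if "z \<in> D k" for z k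
  proof -
    have "f z = (\<Sum>j\<in>{k}. indicator (D j) z *\<^sub>R F j z)"
      unfolding f_def using D_notin[OF that] by (intro suminf_finite) auto
    then show ?thesis using that by simp
  qed
  have f_core: "indicator (core n) z *\<^sub>R f z = (\<Sum>k\<le>n. indicator (D k) z *\<^sub>R F k z)" for n z
  proof (cases "z \<in> core n")
    case True
    then obtain k where k: "k \<le> n" "z \<in> D k" unfolding core_D by blast
    have "(\<Sum>j\<le>n. indicator (D j) z *\<^sub>R F j z) = (\<Sum>j\<in>{k}. indicator (D j) z *\<^sub>R F j z)"
      using k D_notin[OF k(2)] by (intro sum.mono_neutral_right) auto
    then show ?thesis using True k f_D[OF k(2)] by simp
  qed (simp add: core_D)
  show ?thesis
  proof (rule that[of f])
    show "integrable lebesgue (\<lambda>z. indicator (core n) z *\<^sub>R f z)" for n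
      unfolding f_core using F(1) by (intro Bochner_Integration.integrable_sum)
    fix n and A :: "((real^'n) \<times> (real^'m)) set" assume A[measurable]: "A \<in> sets lebesgue" and
        sub: "A \<subseteq> core n"
    have "indicator A z = (\<Sum>k\<le>n. indicator (A \<inter> D k) z :: 'k)" for z
    proof (cases "z \<in> A")
      case True
      then obtain k where k: "k \<le> n" "z \<in> D k" using sub unfolding core_D by blast
      have "(\<Sum>j\<le>n. indicator (A \<inter> D j) z :: 'k) = (\<Sum>j\<in>{k}. indicator (A \<inter> D j) z)"
        using k D_notin[OF k(2)] by (intro sum.mono_neutral_right) auto
      then show ?thesis using True k by simp
    qed simp
    then have "\<Lambda> (indicator A) = \<Lambda> (\<lambda>z. \<Sum>k\<le>n. indicator (A \<inter> D k) z)" by presburger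
    also have "\<dots> = (\<Sum>k\<le>n. \<Lambda> (indicator (A \<inter> D k)))"
      using sub by (intro sum_core_bounded[of _ _ n] indicator_core_bounded) auto
    also have "\<dots> = (\<Sum>k\<le>n. \<integral>z. indicator A z *\<^sub>R (indicator (D k) z *\<^sub>R F k z) \<partial>lebesgue)"
      by (simp only: F(2)[OF A])
    also have "\<dots> = (\<integral>z. (\<Sum>k\<le>n. indicator A z *\<^sub>R (indicator (D k) z *\<^sub>R F k z)) \<partial>lebesgue)"
      by (rule Bochner_Integration.integral_sum[symmetric]) (intro integrable_mult_indicator A F(1))
    also have "\<dots> = (\<integral>z. indicator A z *\<^sub>R f z \<partial>lebesgue)"
    proof (rule Bochner_Integration.integral_cong[OF refl])
      fix z
      show "(\<Sum>k\<le>n. indicator A z *\<^sub>R (indicator (D k) z *\<^sub>R F k z)) = indicator A z *\<^sub>R f z"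
        using sub f_core[of n z] by (cases "z \<in> A") (auto simp: indicator_def)
    qed
    finally show "\<Lambda> (indicator A) = (\<integral>z. indicator A z *\<^sub>R f z \<partial>lebesgue)" .
  qed simp
qed

lemma representation_finite_range:
  assumes [measurable]: "f \<in> borel_measurable lebesgue"
    and int: "\<And>n. integrable lebesgue (\<lambda>z. indicator (core n) z *\<^sub>R f z)"
    and ind: "\<And>n A. A \<in> sets lebesgue \<Longrightarrow> A \<subseteq> core n \<Longrightarrow>
        \<Lambda> (indicator A) = (\<integral>z. indicator A z *\<^sub>R f z \<partial>lebesgue)"
    and s: "s \<in> core_bounded n" "finite (range s)"
  shows "\<Lambda> s = (\<integral>z. f z * s z \<partial>lebesgue)"
proof -
  from s(1) have [measurable]: "s \<in> borel_measurable lebesgue" by measurable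
  \<comment> \<open>Intersecting with \<open>core n\<close> also brings the level set of 0 into the
    range of \<open>ind\<close>.\<close>
  define A where "A y = {z \<in> core n. s z = y}" for y
  have A: "A y \<in> sets lebesgue" "A y \<subseteq> core n" for y unfolding A_def by auto
  have supp: "s z = 0" if "z \<notin> core n" for z using s(1) that unfolding core_bounded_def by blast
  define Y where "Y = range s"
  have s_eq: "s = (\<lambda>z. \<Sum>y\<in>Y. y * indicator (A y) z)"
  proof
    fix z
    have "(\<Sum>y\<in>Y. y * indicator (A y) z) = (\<Sum>y\<in>{s z}. y * indicator (A y) z)"
      using s(2) by (intro sum.mono_neutral_right) (auto simp: Y_def A_def indicator_def)
    also have "\<dots> = s z" using supp[of z] by (auto simp: A_def indicator_def)
    finally show "s z = (\<Sum>y\<in>Y. y * indicator (A y) z)" by simp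
  qed
  have int_A: "integrable lebesgue (\<lambda>z. indicator (A y) z *\<^sub>R f z)" for y
  proof -
    have "indicator (A y) z *\<^sub>R f z = indicator (A y) z *\<^sub>R (indicator (core n) z *\<^sub>R f z)" for z
      using A(2)[of y] by (auto simp: indicator_def)
    then show ?thesis using integrable_mult_indicator[OF A(1) int[of n]] by (simp only:)
  qed
  have "\<Lambda> s = \<Lambda> (\<lambda>z. \<Sum>y\<in>Y. y * indicator (A y) z)" using s_eq by simp
  also have "\<dots> = (\<Sum>y\<in>Y. \<Lambda> (\<lambda>z. y * indicator (A y) z))"
    using s(2) A by (intro sum_core_bounded[of _ _ n] core_bounded_mult indicator_core_bounded)
        (auto simp: Y_def)
  also have "\<dots> = (\<Sum>y\<in>Y. y * (\<integral>z. indicator (A y) z *\<^sub>R f z \<partial>lebesgue))"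
  proof (rule sum.cong[OF refl])
    fix y
    have "\<Lambda> (\<lambda>z. y * indicator (A y) z) = y * \<Lambda> (indicator (A y))"
      by (rule scale[OF core_bounded_block_herz(1)[OF indicator_core_bounded[OF A]]])
    then show "\<Lambda> (\<lambda>z. y * indicator (A y) z) = y * (\<integral>z. indicator (A y) z *\<^sub>R f z \<partial>lebesgue)"
      by (simp only: ind[OF A])
  qed
  also have "\<dots> = (\<Sum>y\<in>Y. (\<integral>z. y * (indicator (A y) z *\<^sub>R f z) \<partial>lebesgue))"
    by (simp del: mult_scaleR_right)
  also have "\<dots> = (\<integral>z. (\<Sum>y\<in>Y. y * (indicator (A y) z *\<^sub>R f z)) \<partial>lebesgue)"
    using int_A by (intro Bochner_Integration.integral_sum[symmetric]) (auto simp del: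
        mult_scaleR_right)
  also have "\<dots> = (\<integral>z. f z * s z \<partial>lebesgue)"
  proof (rule Bochner_Integration.integral_cong[OF refl])
    fix z
    have "(\<Sum>y\<in>Y. y * (indicator (A y) z *\<^sub>R f z)) = (\<Sum>y\<in>Y. f z * (y * indicator (A y) z))"
      by (intro sum.cong refl) (auto simp: indicator_def)
    also have "\<dots> = f z * s z" by (simp only: fun_cong[OF s_eq, of z] sum_distrib_left)
    finally show "(\<Sum>y\<in>Y. y * (indicator (A y) z *\<^sub>R f z)) = f z * s z" .
  qed
  finally show ?thesis .
qed

text \<open>Truncated simple functions approximate b in two ways: in the Herz norm, dominated by 3
  times the modulus of b, which controls the functional; and in the integral against f, dominated by
  2 times the modulus of f b, where integrability of f b enters.\<close>

lemma representation_herz: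
  assumes [measurable]: "f \<in> borel_measurable lebesgue"
    and int: "\<And>n. integrable lebesgue (\<lambda>z. indicator (core n) z *\<^sub>R f z)"
    and ind: "\<And>n A. A \<in> sets lebesgue \<Longrightarrow> A \<subseteq> core n \<Longrightarrow>
        \<Lambda> (indicator A) = (\<integral>z. indicator A z *\<^sub>R f z \<partial>lebesgue)"
    and b[measurable]: "b \<in> borel_measurable lebesgue" and supp: "AE z in lebesgue. z \<notin> cube l1 \<times>
        cube l2 \<longrightarrow> b z = 0"
    and fin: "herz_norm \<alpha> p q b < top" and fb: "integrable lebesgue (\<lambda>z. f z * b z)"
  shows "\<Lambda> b = (\<integral>z. f z * b z \<partial>lebesgue)"
proof -
  obtain s where s: "\<And>i. simple_function lebesgue (s i)" "\<And>z. (\<lambda>i. s i z) \<longlonglongrightarrow> b z"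
    "\<And>i z. norm (s i z) \<le> 2 * norm (b z)"
    \<comment> \<open>Approximation relative to the base point 0 gives the pointwise factor 2, from
      which the dominating constants 2 and 3 arise.\<close>
    using borel_measurable_implies_sequence_metric[OF b, of 0] by auto
  define t where "t n z = indicator (core n) z *\<^sub>R s n z" for n z
  have [measurable]: "s n \<in> borel_measurable lebesgue" for n
      by (rule borel_measurable_simple_function[OF s(1)])
  have [measurable]: "t n \<in> borel_measurable lebesgue" for n unfolding t_def by measurable
  have t_le: "norm (t n z) \<le> 2 * norm (b z)" for n z
    using s(3)[of n z] by (simp add: t_def indicator_def)
  have diff_le: "norm (b z - t n z) \<le> 3 * norm (b z)" for n z
    using norm_triangle_ineq4[of "b z" "t n z"] t_le[of n z] by simp
  have lim: "AE z in lebesgue. (\<lambda>n. t n z) \<longlonglongrightarrow> b z"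
  proof (use AE_core in eventually_elim)
    case (elim z)
    then obtain N where N: "z \<in> core N" by blast
    have "\<forall>\<^sub>F n in sequentially. s n z = t n z"
      using eventually_ge_at_top[of N]
    proof eventually_elim
      case (elim n)
      then have "z \<in> core n" using N core_mono by blast
      then show ?case by (simp add: t_def)
    qed
    then show ?case using s(2)[of z] by (rule Lim_transform_eventually[rotated])
  qed
  have range_s: "finite (range (s n))" for n using simple_functionD(1)[OF s(1)[of n]] by simp
  have range_t: "finite (range (t n))" for n
    by (rule finite_subset[OF _ finite_UnI[OF range_s[of n], of "{0}"]]) (auto simp: t_def
        indicator_def)
  have t_cb: "t n \<in> core_bounded n" for n
  proof -
    have "norm (t n z) \<le> (\<Sum>y\<in>range (t n). norm y)" for z
      using range_t[of n] by (intro member_le_sum) auto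
    then show ?thesis by (auto simp: core_bounded_def t_def)
  qed
  have herz3: "herz_norm \<alpha> p q (\<lambda>z. b z - t n z) < top" for n
  proof -
    have "eherz \<alpha> p q (\<lambda>z. ennreal (norm (b z - t n z)))
        \<le> eherz \<alpha> p q (\<lambda>z. ennreal 3 * ennreal (norm (b z)))"
      using exponents diff_le
          by (intro eherz_mono) (auto simp: ennreal_mult[symmetric] simp del: ennreal_numeral)
    also have "\<dots> = ennreal 3 * eherz \<alpha> p q (\<lambda>z. ennreal (norm (b z)))"
      using exponents by (intro eherz_cmult) auto
    also have "\<dots> < top" using fin exponents by (simp add: herz_norm_eq ennreal_mult_less_top)
    finally show ?thesis using exponents by (simp add: herz_norm_eq)
  qed
  have "(\<lambda>n. eherz \<alpha> p q (\<lambda>z. ennreal (norm (b z - t n z)))) \<longlonglongrightarrow> 0"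
  proof (rule eherz_tendsto_0[where v = "\<lambda>z. ennreal 3 * ennreal (norm (b z))"])
    show "AE z in lebesgue. ennreal (norm (b z - t n z)) \<le> ennreal 3 * ennreal (norm (b z))" for n
      using diff_le by (auto simp: ennreal_mult[symmetric] simp del: ennreal_numeral)
    show "eherz \<alpha> p q (\<lambda>z. ennreal 3 * ennreal (norm (b z))) < top"
      using fin exponents by (subst eherz_cmult) (auto simp: herz_norm_eq ennreal_mult_less_top)
    show "AE z in lebesgue. (\<lambda>n. ennreal (norm (b z - t n z))) \<longlonglongrightarrow> 0"
      using lim
    proof eventually_elim
      case (elim z)
      have "(\<lambda>n. norm (b z - t n z)) \<longlonglongrightarrow> norm (b z - b z)"
        by (intro tendsto_intros elim)
      then show ?case using tendsto_ennrealI[of "\<lambda>n. norm (b z - t n z)" 0] by simp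
    qed
  qed (use exponents in auto)
  then have "(\<lambda>n. ennreal (C * 2 powr (lam * real_of_int (l1 + l2))) * herz_norm \<alpha> p q (\<lambda>z. b z -
      t n z)) \<longlonglongrightarrow>
      ennreal (C * 2 powr (lam * real_of_int (l1 + l2))) * 0"
    using exponents by (intro ennreal_tendsto_cmult) (auto simp: herz_norm_eq)
  then have lim0: "(\<lambda>n. ennreal (C * 2 powr (lam * real_of_int (l1 + l2))) * herz_norm \<alpha> p q (\<lambda>z.
      b z - t n z)) \<longlonglongrightarrow> 0"
    by simp
  have supp3: "AE z in lebesgue. z \<notin> cube l1 \<times> cube l2 \<longrightarrow> b z - t n z = 0" for n
    using supp
  proof eventually_elim
    case (elim z)
    then show ?case using t_le[of n z] by auto
  qed
  have "(\<lambda>n. ennreal (norm (\<Lambda> (\<lambda>z. b z - t n z)))) \<longlonglongrightarrow> 0"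
    by (rule tendsto_sandwich[OF _ _ tendsto_const lim0])
       (auto intro!: always_eventually bound_cube supp3 herz3 simp del: of_int_add)
  then have "(\<lambda>n. norm (\<Lambda> (\<lambda>z. b z - t n z))) \<longlonglongrightarrow> 0"
    using tendsto_ennreal_iff[of "\<lambda>n. norm (\<Lambda> (\<lambda>z. b z - t n z))" sequentially 0] by simp
  then have "(\<lambda>n. \<Lambda> (\<lambda>z. b z - t n z)) \<longlonglongrightarrow> 0" by (rule tendsto_norm_zero_cancel)
  moreover have "\<Lambda> (\<lambda>z. b z - t n z) = \<Lambda> b - \<Lambda> (t n)" for n
  proof -
    have "(\<lambda>z. b z - t n z) \<in> block_herz \<alpha> lam p q"
      by (rule block_herz_norm_le_herz(1)[OF _ supp3 herz3]) measurable
    from add[OF core_bounded_block_herz(1)[OF t_cb[of n]] this] show ?thesis by simp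
  qed
  ultimately have "(\<lambda>n. \<Lambda> b - (\<Lambda> b - \<Lambda> (t n))) \<longlonglongrightarrow> \<Lambda> b - 0"
    by (intro tendsto_diff tendsto_const) simp
  then have "(\<lambda>n. \<integral>z. f z * t n z \<partial>lebesgue) \<longlonglongrightarrow> \<Lambda> b"
    using representation_finite_range[OF _ int ind t_cb range_t] by simp
  moreover have "(\<lambda>n. \<integral>z. f z * t n z \<partial>lebesgue) \<longlonglongrightarrow> (\<integral>z. f z * b z \<partial>lebesgue)"
  proof (rule integral_dominated_convergence[where w = "\<lambda>z. 2 * norm (f z * b z)"])
    show "integrable lebesgue (\<lambda>z. 2 * norm (f z * b z))" using fb by auto
    show "AE z in lebesgue. (\<lambda>n. f z * t n z) \<longlonglongrightarrow> f z * b z"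
      using lim by eventually_elim (intro tendsto_intros)
    show "AE z in lebesgue. norm (f z * t n z) \<le> 2 * norm (f z * b z)" for n
      using mult_left_mono[OF t_le norm_ge_zero, of "f _"] by (auto simp: norm_mult mult_ac)
  qed auto
  ultimately show ?thesis by (rule LIMSEQ_unique)
qed

text \<open>First the formula holds for blocks with integrable product; these suffice to bound the
  Morrey-Herz norm of f by C. The bound makes all products with blocks integrable, so the formula
  holds for every block, and both functionals are sums of the same series.\<close>

lemma representation:
  obtains f where "f \<in> borel_measurable lebesgue" "morrey_herz_norm (- \<alpha>) lam p' q' f < top"
    "\<And>g. g \<in> block_herz \<alpha> lam p q \<Longrightarrow> \<Lambda> g = (\<integral>z. f z * g z \<partial>lebesgue)"
proof -
  obtain f where f[measurable]: "f \<in> borel_measurable lebesgue"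
    and int: "\<And>n. integrable lebesgue (\<lambda>z. indicator (core n) z *\<^sub>R f z)"
    and ind: "\<And>n A. A \<in> sets lebesgue \<Longrightarrow> A \<subseteq> core n \<Longrightarrow>
        \<Lambda> (indicator A) = (\<integral>z. indicator A z *\<^sub>R f z \<partial>lebesgue)"
    using representation_indicator by blast
  have block: "\<Lambda> b = (\<integral>z. f z * b z \<partial>lebesgue)"
    if b: "b \<in> herz_block \<alpha> lam p q" and fb: "integrable lebesgue (\<lambda>z. f z * b z)" for b
  proof -
    from b obtain l1 l2 where bb: "b \<in> borel_measurable lebesgue" "AE z in lebesgue. z \<notin> cube l1 \<times>
        cube l2 \<longrightarrow> b z = 0"
      and norm: "herz_norm \<alpha> p q b \<le> ennreal (2 powr (- (lam * real_of_int (l1 + l2))))"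
      by (auto simp: herz_block_def)
    have "herz_norm \<alpha> p q b < top" using norm le_less_trans by fastforce
    with bb fb show ?thesis by (intro representation_herz[OF f int ind])
  qed
  have "morrey_herz_norm (- \<alpha>) lam p' q' f \<le> ennreal C"
  proof (rule morrey_le_of_block_pairing[OF f])
    fix b :: "(real^'n) \<times> (real^'m) \<Rightarrow> 'k" assume b: "b \<in> herz_block \<alpha> lam p q"
      and fin: "(\<integral>\<^sup>+ z. ennreal (norm (f z * b z)) \<partial>lebesgue) < top"
    from b have [measurable]: "b \<in> borel_measurable lebesgue" by (simp add: herz_block_def)
    \<comment> \<open>Phase correction: f u is the modulus of f b, while u is no larger than b and
      so is again a block. Where f vanishes, \<open>inverse 0 = 0\<close> makes u vanish as
      well.\<close>
    define u where "u z = of_real (norm (f z * b z)) * inverse (f z)" for z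
    have [measurable]: "u \<in> borel_measurable lebesgue" unfolding u_def by measurable
    have fu: "f z * u z = of_real (norm (f z * b z))" for z
        by (cases "f z = 0") (simp_all add: u_def)
    have u_le: "norm (u z) \<le> norm (b z)" for z
      by (cases "f z = 0", simp_all add: u_def norm_mult norm_inverse) (simp add: field_simps)
    from b obtain l1 l2 where supp: "AE z in lebesgue. z \<notin> cube l1 \<times> cube l2 \<longrightarrow> b z = 0"
      and norm: "herz_norm \<alpha> p q b \<le> ennreal (2 powr (- (lam * real_of_int (l1 + l2))))"
      by (auto simp: herz_block_def)
    have u: "u \<in> herz_block \<alpha> lam p q"
    proof (rule herz_blockI)
      show "AE z in lebesgue. z \<notin> cube l1 \<times> cube l2 \<longrightarrow> u z = 0"
        using supp by eventually_elim (simp add: u_def)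
      have "eherz \<alpha> p q (\<lambda>z. ennreal (norm (u z))) \<le> eherz \<alpha> p q (\<lambda>z. ennreal (norm (b z)))"
        using exponents u_le by (intro eherz_mono) (auto intro: ennreal_leI)
      then show "eherz \<alpha> p q (\<lambda>z. ennreal (norm (u z)))
          \<le> ennreal (2 powr (- (lam * real_of_int (l1 + l2))))"
        using norm exponents by (simp add: herz_norm_eq)
    qed simp
    have int_fb: "integrable lebesgue (\<lambda>z. norm (f z * b z))"
      using fin by (intro integrable_norm integrableI_bounded) auto
    then have "integrable lebesgue (\<lambda>z. f z * u z)" unfolding fu by (rule integrable_of_real)
    from block[OF u this] have \<Lambda>u: "\<Lambda> u = of_real (\<integral>z. norm (f z * b z) \<partial>lebesgue)"
      unfolding fu by (simp only: integral_bounded_linear[OF bounded_linear_of_real int_fb])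
    have "(\<integral>\<^sup>+ z. ennreal (norm (f z * b z)) \<partial>lebesgue) = ennreal (\<integral>z. norm (f z * b z) \<partial>lebesgue)"
      by (rule nn_integral_eq_integral[OF int_fb]) simp
    also have "\<dots> = ennreal (norm (\<Lambda> u))" unfolding \<Lambda>u by simp
    also have "\<dots> \<le> ennreal C * block_herz_norm \<alpha> lam p q u"
        by (intro bound herz_block_in_block_herz u)
    also have "\<dots> \<le> ennreal C * 1" by (intro mult_left_mono herz_block_in_block_herz u) simp
    finally show "(\<integral>\<^sup>+ z. ennreal (norm (f z * b z)) \<partial>lebesgue) \<le> ennreal C" by simp
  qed
  then have morrey: "morrey_herz_norm (- \<alpha>) lam p' q' f < top" using le_less_trans by fastforce
  have \<Lambda>_dual: "\<Lambda> \<in> block_herz_dual \<alpha> lam p q"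
    unfolding block_herz_dual_def using add scale bound C by blast
  note dual = functional_in_dual[OF f morrey]
  show ?thesis
  proof (rule that[OF f morrey])
    fix g :: "(real^'n) \<times> (real^'m) \<Rightarrow> 'k" assume "g \<in> block_herz \<alpha> lam p q"
    then obtain c b where g: "g \<in> borel_measurable lebesgue" and rep: "block_rep \<alpha> lam p q g c b"
      by (auto simp: block_herz_def)
    \<comment> \<open>The integrability required by \<open>block\<close> now comes from
      \<open>dual(1)\<close>.\<close>
    have "\<Lambda> (b k) = (\<integral>z. f z * b k z \<partial>lebesgue)" for k
      using rep by (intro block dual(1) herz_block_in_block_herz) (auto simp: block_rep_def)
    then show "\<Lambda> g = (\<integral>z. f z * g z \<partial>lebesgue)"
      using dual_sums[OF \<Lambda>_dual g rep] dual_sums[OF dual(2) g rep] by (simp add: sums_unique2)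
  qed
qed

end

section \<open>Local integrability and the duality theorem\<close>

text \<open>Shells approaching a coordinate subspace have an index tending to minus infinity. For
  positive gamma their weights form a geometric series with ratio 2^(-gamma).\<close>

lemma nn_integral_geometric_atMost:
  fixes n :: int
  assumes "0 < \<gamma>"
  shows "(\<integral>\<^sup>+ i. ennreal (2 powr (real_of_int i * \<gamma>)) * indicator {..n} i \<partial>count_space UNIV) < top"
proof -
  have bij: "bij_betw (\<lambda>a::nat. n - int a) UNIV {..n}"
    by (rule bij_betwI[where g = "\<lambda>i. nat (n - i)"]) auto
  have r: "norm (2 powr (- \<gamma>)) < 1" using assms by (simp add: powr_less_one)
  have "(\<integral>\<^sup>+ i. ennreal (2 powr (real_of_int i * \<gamma>)) * indicator {..n} i \<partial>count_space UNIV) =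
     (\<integral>\<^sup>+ i. ennreal (2 powr (real_of_int i * \<gamma>)) \<partial>count_space {..n})"
    by (subst nn_integral_count_space_indicator) auto
  also have "\<dots> = (\<integral>\<^sup>+ a. ennreal (2 powr (real_of_int (n - int a) * \<gamma>)) \<partial>count_space UNIV)"
    by (rule nn_integral_bij_count_space[OF bij, symmetric])
  also have "\<dots> = (\<Sum>a. ennreal (2 powr (real_of_int (n - int a) * \<gamma>)))"
    by (rule nn_integral_count_space_nat)
  also have "\<dots> = (\<Sum>a. ennreal (2 powr (real_of_int n * \<gamma>) * (2 powr (- \<gamma>)) ^ a))"
    by (simp add: powr_realpow[symmetric] powr_powr powr_add[symmetric] algebra_simps)
  also have "\<dots> = ennreal (\<Sum>a. 2 powr (real_of_int n * \<gamma>) * (2 powr (- \<gamma>)) ^ a)"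
    using r by (intro suminf_ennreal2 summable_mult summable_geometric) auto
  finally show ?thesis by simp
qed

lemma cube_shell_index_le: "x \<in> cube n \<Longrightarrow> x \<in> cube_shell i \<Longrightarrow> i \<le> n"
  using cube_mono[of n "i - 1"] by (force simp: cube_shell_def)

context herz_duality
begin

text \<open>The rectangle indexed by the shell itself is tested in the supremum. Undoing its Morrey
  factor contributes \<open>lam\<close> to the exponent, undoing the Herz weight contributes
  alpha.\<close>

lemma nnorm_shell_le_morrey:
  fixes f :: "(real^'n) \<times> (real^'m) \<Rightarrow> 'k::{real_normed_field, euclidean_space}"
  shows "nnorm lebesgue p' (\<lambda>z. ennreal (norm (f z)) * indicator (shell ij) z)
    \<le> weight (\<alpha> + lam) ij * morrey_herz_norm (- \<alpha>) lam p' q' f"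
proof -
  define R where "R = (cube (fst ij) \<times> cube (snd ij) :: ((real^'n) \<times> (real^'m)) set)"
  define N where "N = nnorm lebesgue p' (\<lambda>z. ennreal (norm (f z)) * indicator (shell ij) z)"
  have sub: "shell ij \<subseteq> R" by (auto simp: R_def shell_def cube_shell_def)
  have "ennreal (norm (f z)) * indicator R z * indicator (shell ij) z
      = ennreal (norm (f z)) * indicator (shell ij) z" for z
    using sub by (auto simp: indicator_def)
  then have "weight (- \<alpha>) ij * N \<le> eherz (- \<alpha>) p' q' (\<lambda>z. ennreal (norm (f z)) * indicator R z)"
    using nnorm_shell_le_eherz[OF exponents(3,4), of "- \<alpha>" ij "\<lambda>z. ennreal (norm (f z)) *
        indicator R z"]
    by (simp add: N_def)
  then have "weight (- lam) ij * (weight (- \<alpha>) ij * N) \<le>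
      weight (- lam) ij * eherz (- \<alpha>) p' q' (\<lambda>z. ennreal (norm (f z)) * indicator R z)"
    by (rule mult_left_mono) simp
  also have "\<dots> \<le> morrey_herz_norm (- \<alpha>) lam p' q' f"
    using eherz_cube_le_morrey[of "fst ij" "snd ij" f] by (simp add: weight_def R_def)
  finally have "weight (\<alpha> + lam) ij * (weight (- lam) ij * (weight (- \<alpha>) ij * N))
      \<le> weight (\<alpha> + lam) ij * morrey_herz_norm (- \<alpha>) lam p' q' f"
    by (rule mult_left_mono) simp
  moreover have "weight (\<alpha> + lam) ij = weight lam ij * weight \<alpha> ij"
    by (simp add: weight_def ennreal_mult[symmetric] powr_add[symmetric] algebra_simps)
  then have "weight (\<alpha> + lam) ij * (weight (- lam) ij * (weight (- \<alpha>) ij * N)) =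
      (weight lam ij * weight (- lam) ij) * ((weight \<alpha> ij * weight (- \<alpha>) ij) * N)"
    by (simp only: mult_ac)
  ultimately show ?thesis by (simp add: weight_minus N_def)
qed

text \<open>G collects the index pairs of the shells that K can meet. It will be finite for K away
  from the coordinate subspaces and only bounded above for general compact K.\<close>

lemma Lnorm_finite:
  fixes f :: "(real^'n) \<times> (real^'m) \<Rightarrow> 'k::{real_normed_field, euclidean_space}"
  assumes [measurable]: "f \<in> borel_measurable lebesgue" "K \<in> sets lebesgue"
    and fin: "morrey_herz_norm (- \<alpha>) lam p' q' f < top"
    and G: "\<And>z ij. z \<in> K \<Longrightarrow> z \<in> shell ij \<Longrightarrow> ij \<in> G"
    and sum: "(\<integral>\<^sup>+ ij. epowr (weight (\<alpha> + lam) ij) p' * indicator G ij \<partial>count_space UNIV) < top"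
  shows "Lnorm p' (\<lambda>z. indicator K z *\<^sub>R f z) < top"
proof -
  let ?m = "morrey_herz_norm (- \<alpha>) lam p' q' f"
  let ?N = "\<lambda>ij. nnorm lebesgue p' (\<lambda>z. ennreal (norm (f z)) * indicator (shell ij) z)"
  have "(\<integral>\<^sup>+ z. epowr (ennreal (norm (indicator K z *\<^sub>R f z))) p' \<partial>lebesgue) =
      (\<integral>\<^sup>+ ij. (\<integral>\<^sup>+ z. epowr (ennreal (norm (indicator K z *\<^sub>R f z))) p' * indicator (shell ij) z
          \<partial>lebesgue) \<partial>count_space UNIV)"
    by (rule nn_integral_shells) measurable
  also have "\<dots> \<le> (\<integral>\<^sup>+ ij. epowr ?m p' * (epowr (weight (\<alpha> + lam) ij) p' * indicator G ij)
      \<partial>count_space UNIV)"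
  proof (rule nn_integral_mono)
    fix ij
    show "(\<integral>\<^sup>+ z. epowr (ennreal (norm (indicator K z *\<^sub>R f z))) p' * indicator (shell ij) z
        \<partial>lebesgue)
       \<le> epowr ?m p' * (epowr (weight (\<alpha> + lam) ij) p' * indicator G ij)"
    proof (cases "ij \<in> G")
      case True
      have "(\<integral>\<^sup>+ z. epowr (ennreal (norm (indicator K z *\<^sub>R f z))) p' * indicator (shell ij) z
          \<partial>lebesgue)
         \<le> (\<integral>\<^sup>+ z. epowr (ennreal (norm (f z)) * indicator (shell ij) z) p' \<partial>lebesgue)"
        by (intro nn_integral_mono) (auto simp: indicator_def)
      also have "\<dots> = epowr (?N ij) p'" using exponents by (simp add: epowr_nnorm)
      also have "\<dots> \<le> epowr (weight (\<alpha> + lam) ij * ?m) p'"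
        using exponents by (intro epowr_mono nnorm_shell_le_morrey) auto
      finally show ?thesis using True by (simp add: epowr_mult mult.commute)
    next
      case False
      then have "epowr (ennreal (norm (indicator K z *\<^sub>R f z))) p' * indicator (shell ij) z
          = 0" for z
        using G[of z ij] by (cases "z \<in> K") (auto simp: indicator_def)
      then show ?thesis by (simp only: nn_integral_const) simp
    qed
  qed
  also have "\<dots> = epowr ?m p' * (\<integral>\<^sup>+ ij. epowr (weight (\<alpha> + lam) ij) p' * indicator G ij
      \<partial>count_space UNIV)"
    by (rule nn_integral_cmult) simp
  also have "\<dots> < top" using sum fin by (simp add: ennreal_mult_less_top)
  finally show ?thesis by (simp add: Lnorm_eq_nnorm nnorm_def)
qed

lemma morrey_in_Lloc:
  fixes f :: "(real^'n) \<times> (real^'m) \<Rightarrow> 'k::{real_normed_field, euclidean_space}"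
  assumes f: "f \<in> borel_measurable lebesgue" "morrey_herz_norm (- \<alpha>) lam p' q' f < top"
  shows "f \<in> Lloc p' ((- {0}) \<times> (- {0}))"
proof -
  have "Lnorm p' (\<lambda>z. indicator K z *\<^sub>R f z) < top"
    if K: "compact K" "K \<subseteq> (- {0}) \<times> (- {0})" for K :: "((real^'n) \<times> (real^'m)) set"
  proof -
    obtain n where n: "K \<subseteq> core n" using compact_subset_core[OF K] by blast
    let ?G = "{- int n..int n} \<times> {- int n..int n}"
    have "(\<integral>\<^sup>+ ij. epowr (weight (\<alpha> + lam) ij) p' * indicator ?G ij \<partial>count_space UNIV) =
        (\<Sum>ij\<in>?G. epowr (weight (\<alpha> + lam) ij) p' * indicator ?G ij)"
      by (intro nn_integral_count_space') auto
    also have "\<dots> < top" by (auto simp: less_top[symmetric] weight_def)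
    finally have sum: "(\<integral>\<^sup>+ ij. epowr (weight (\<alpha> + lam) ij) p' * indicator ?G ij \<partial>count_space
        UNIV) < top" .
    have G: "ij \<in> ?G" if "z \<in> K" "z \<in> shell ij" for z ij
      using mem_core_shell[of z n ij] n that by blast
    have "K \<in> sets lebesgue"
      using K(1) by (simp add: borel_compact)
    then show ?thesis by (rule Lnorm_finite[OF f(1) _ f(2) G sum])
  qed
  then show ?thesis using f(1) by (simp add: Lloc_def)
qed

text \<open>A compact set may touch the coordinate subspaces and meet infinitely many shells. The
  sum over its index range factors into two geometric series, and \<open>0 < \<alpha> + lam\<close>
  makes both converge.\<close>

lemma morrey_in_Lloc_UNIV:
  fixes f :: "(real^'n) \<times> (real^'m) \<Rightarrow> 'k::{real_normed_field, euclidean_space}"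
  assumes f: "f \<in> borel_measurable lebesgue" "morrey_herz_norm (- \<alpha>) lam p' q' f < top"
    and pos: "0 < \<alpha> + lam"
  shows "f \<in> Lloc p' UNIV"
proof -
  have "Lnorm p' (\<lambda>z. indicator K z *\<^sub>R f z) < top"
    if K: "compact K" for K :: "((real^'n) \<times> (real^'m)) set"
  proof -
    obtain B where B: "\<And>z. z \<in> K \<Longrightarrow> norm z \<le> B"
      using compact_imp_bounded[OF K] by (auto simp: bounded_iff)
    obtain a b :: nat where ab: "\<And>x :: real^'n. norm x \<le> B \<Longrightarrow> x \<in> cube (int a)"
        "\<And>x :: real^'m. norm x \<le> B \<Longrightarrow> x \<in> cube (int b)"
      using cball_subset_cube[of B] by meson
    let ?G = "{..int a} \<times> {..int b}"
    define h where "h i = ennreal (2 powr (real_of_int i * ((\<alpha> + lam) * p')))" for i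
    have h: "(\<integral>\<^sup>+ i. h i * indicator {..n} i \<partial>count_space UNIV) < top" for n
      unfolding h_def using pos exponents by (intro nn_integral_geometric_atMost) simp
    have "epowr (weight (\<alpha> + lam) (i, j)) p' * indicator ?G (i, j) =
        (h i * indicator {..int a} i) * (h j * indicator {..int b} j)" for i j
      by (simp add: weight_def h_def powr_powr ennreal_mult[symmetric] powr_add[symmetric]
          indicator_def algebra_simps)
    then have "(\<integral>\<^sup>+ ij. epowr (weight (\<alpha> + lam) ij) p' * indicator ?G ij \<partial>count_space UNIV) =
       (\<integral>\<^sup>+ i. h i * indicator {..int a} i \<partial>count_space UNIV) * (\<integral>\<^sup>+ j. h j * indicator {..int b}
           j \<partial>count_space UNIV)"
      by (simp add: nn_integral_fst_count_space[symmetric] nn_integral_cmult nn_integral_multc)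
    also have "\<dots> < top" using h by (simp add: ennreal_mult_less_top)
    finally have sum: "(\<integral>\<^sup>+ ij. epowr (weight (\<alpha> + lam) ij) p' * indicator ?G ij \<partial>count_space
        UNIV) < top" .
    have G: "ij \<in> ?G" if "z \<in> K" "z \<in> shell ij" for z ij
    proof -
      have "fst z \<in> cube (int a)" "snd z \<in> cube (int b)"
        using B[OF that(1)] norm_fst_le[of "fst z" "snd z"] norm_snd_le[of "snd z" "fst z"]
        by (auto intro!: ab)
      then show ?thesis
        using that(2) by (cases ij) (auto simp: shell_def mem_Times_iff dest: cube_shell_index_le)
    qed
    have "K \<in> sets lebesgue"
      using K(1) by (simp add: borel_compact)
    then show ?thesis by (rule Lnorm_finite[OF f(1) _ f(2) G sum])
  qed
  then show ?thesis using f(1) by (simp add: Lloc_def)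
qed

end

theorem theorem3p2:
  fixes \<alpha> lam p q p' q' :: real
    and M :: "((real^'n) \<times> (real^'m) \<Rightarrow> 'k::{real_normed_field, euclidean_space}) set"
    and B :: "((real^'n) \<times> (real^'m) \<Rightarrow> 'k) set"
  assumes "1 < p" "1 < q" "0 < lam"
    and "1 / p + 1 / p' = 1" "1 / q + 1 / q' = 1"
    and M_eq: "M = morrey_herz (- \<alpha>) lam p' q'"
    and B_eq: "B = block_herz \<alpha> lam p q"
  shows
    "(\<forall>f\<in>M. (\<forall>g\<in>B. integrable lebesgue (\<lambda>z. f z * g z)) \<and>
             (\<lambda>g. \<integral>z. f z * g z \<partial>lebesgue) \<in> block_herz_dual \<alpha> lam p q) \<and>
     (\<forall>\<Lambda>\<in>block_herz_dual \<alpha> lam p q. \<exists>f\<in>M. \<forall>g\<in>B. \<Lambda> g = (\<integral>z. f z * g z \<partial>lebesgue)) \<and>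
     (\<exists>C\<ge>1. \<forall>f\<in>M.
        ennreal (1 / C) * morrey_herz_norm (- \<alpha>) lam p' q' f \<le> pairing_norm \<alpha> lam p q f \<and>
        pairing_norm \<alpha> lam p q f \<le> ennreal C * morrey_herz_norm (- \<alpha>) lam p' q' f) \<and>
     morrey_herz_on (- {(0, 0)}) (- \<alpha>) lam p' q' \<subseteq> M \<and>
     (0 < \<alpha> + lam \<longrightarrow> morrey_herz_on (- {(0, 0)}) (- \<alpha>) lam p' q' = M)"
proof -
  interpret herz_duality \<alpha> lam p q p' q'
    using assms by unfold_locales auto
  \<comment> \<open>Off the coordinate subspaces local integrability follows from the finite norm,
    so membership reduces to measurability and this norm.\<close>
  have M: "f \<in> M \<longleftrightarrow> f \<in> borel_measurable lebesgue \<and> morrey_herz_norm (- \<alpha>) lam p' q' f < top" for f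
    unfolding M_eq morrey_herz_on_def using morrey_in_Lloc[of f] by (auto simp: Lloc_def)
  have sub: "morrey_herz_on (- {(0, 0)}) (- \<alpha>) lam p' q' \<subseteq> M"
    by (auto simp: M morrey_herz_on_def Lloc_def)
  show ?thesis
  proof (intro conjI ballI impI sub)
    fix f g assume "f \<in> M" "g \<in> B"
    then show "integrable lebesgue (\<lambda>z. f z * g z)"
      by (intro functional_in_dual(1)) (auto simp: M B_eq)
  next
    fix f assume "f \<in> M"
    then show "(\<lambda>g. \<integral>z. f z * g z \<partial>lebesgue) \<in> block_herz_dual \<alpha> lam p q"
      by (intro functional_in_dual(2)) (auto simp: M)
  next
    fix \<Lambda> :: "((real^'n) \<times> (real^'m) \<Rightarrow> 'k) \<Rightarrow> 'k" assume "\<Lambda> \<in> block_herz_dual \<alpha> lam p q"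
    then obtain C where "herz_functional \<alpha> lam p q p' q' \<Lambda> C"
      unfolding block_herz_dual_def herz_functional_def herz_functional_axioms_def
      using herz_duality_axioms by blast
    then show "\<exists>f\<in>M. \<forall>g\<in>B. \<Lambda> g = (\<integral>z. f z * g z \<partial>lebesgue)"
      by (rule herz_functional.representation) (auto simp: M B_eq)
  next
    show "\<exists>C\<ge>1. \<forall>f\<in>M.
        ennreal (1 / C) * morrey_herz_norm (- \<alpha>) lam p' q' f \<le> pairing_norm \<alpha> lam p q f \<and>
        pairing_norm \<alpha> lam p q f \<le> ennreal C * morrey_herz_norm (- \<alpha>) lam p' q' f"
      by (intro exI[of _ 1]) (auto simp: M pairing_norm_eq_morrey)
  next
    assume "0 < \<alpha> + lam"
    then have "f \<in> morrey_herz_on (- {(0, 0)}) (- \<alpha>) lam p' q'" if "f \<in> M" for f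
      using morrey_in_Lloc_UNIV[of f] that by (auto simp: M morrey_herz_on_def Lloc_def)
    then show "morrey_herz_on (- {(0, 0)}) (- \<alpha>) lam p' q' = M" using sub by blast
  qed
qed

end
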